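(* Let $n\ge2$, let $p,p'$ be integers with $p\ge n$, $p'>n$, $p'\ne p$, and let $\boldsymbol a=(a_1,\dots,a_{n-1}),\boldsymbol b=(b_1,\dots,b_{n-1})\in\mathbb Z_{\ge0}^{n-1}$ be such that $a_n:=p'-n-\sum_{i=1}^{n-1}a_i\ge0$ and $b_n:=p-n-\sum_{i=1}^{n-1}b_i\ge0$. Then the character of the module $\mathcal M^{p',p}_{\boldsymbol a,\boldsymbol b}$ is given by $$\chi^{p',p}_{\boldsymbol a,\boldsymbol b}=\frac1{(q)_\infty}\ \overline\chi^{p',p}_{\boldsymbol\eta,\boldsymbol\xi},\qquad \boldsymbol\eta=\sum_{i=1}^na_i\omega_i,\quad \boldsymbol\xi=\sum_{i=1}^nb_i\omega_i .$$
   Context: **The character of the module.** $\mathcal M^{p',p}_{\boldsymbol a,\boldsymbol b}$ is a graded module (over the quantum continuous $\mathfrak{gl}_\infty$ algebra) with a homogeneous basis $|\lambda^{(1)},\dots,\lambda^{(n)}\rangle$ labeled by the set $$P^{p',p}_{\boldsymbol a,\boldsymbol b}=\{(\lambda^{(1)},\dots,\lambda^{(n)}):\ \lambda^{(i)}\in\mathcal P^+,\ \lambda^{(i)}_j\ge\lambda^{(i+1)}_{j+b_i}-a_i,\ i=1,\dots,n,\ j\in\mathbb Z_{>0}\},\qquad \lambda^{(n+1)}=\lambda^{(1)},$$ where $\mathcal P^+$ is the set of finite partitions (weakly decreasing integer sequences $(\lambda_j)_{j\ge1}$ with finitely many nonzero terms), the degree of the basis vector being $\sum_{i,j}\lambda^{(i)}_j$.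 Only this graded vector space is relevant here. Its character is the formal power series $$\chi^{p',p}_{\boldsymbol a,\boldsymbol b}=\sum_{(\lambda^{(1)},\dots,\lambda^{(n)})\in P^{p',p}_{\boldsymbol a,\boldsymbol b}}q^{\sum_{i=1}^n\sum_{j\ge1}\lambda^{(i)}_j}.$$ **Affine notation.** $\alpha_0,\dots,\alpha_{n-1}$ and $\omega_0,\dots,\omega_{n-1}$ are the simple roots and fundamental weights of $\widehat{\mathfrak{sl}}_n$, $\omega_n=\omega_0$, $\rho=\sum_{i=0}^{n-1}\omega_i$; $Q=\bigoplus_{i=1}^{n-1}\mathbb Z\alpha_i$ is the classical root lattice, on which (and on classical parts of weights) $S_n$ acts as the Weyl group of $\mathfrak{sl}_n$; $(\cdot,\cdot)$ is the standard invariant form with $(\alpha_i,\alpha_i)=2$. In the formula below all pairings are between classical parts: $\omega_0\mapsto0$ and $\omega_i$ ($1\le i\le n-1$) is the $i$-th fundamental weight of $\mathfrak{sl}_n$. $\ell(\sigma)$ is the length of $\sigma\in S_n$. $(q)_\infty=\prod_{i\ge1}(1-q^i)$. **The series $\overline\chi$.** For $\boldsymbol\eta,\boldsymbol\xi$ dominant integral of levels $p'-n$, $p-n$ (i.e. nonnegative integral combinations of the $\omega_i$ with coefficient sum $p'-n$, resp. $p-n$), $$\overline\chi^{p',p}_{\boldsymbol\eta,\boldsymbol\xi}=\frac1{(q)_\infty^{\,n-1}}\sum_{\sigma\in S_n}(-1)^{\ell(\sigma)}\sum_{\alpha\in Q}q^{\frac{p'p}2(\alpha,\alpha)+(p'\sigma(\boldsymbol\xi+\rho)-p(\boldsymbol\eta+\rho),\alpha)+(\boldsymbol\xi+\rho-\sigma(\boldsymbol\xi+\rho),\boldsymbol\eta+\rho)}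 .$$ (These are the alternating-sum expressions for the characters of the modules of the $\mathcal W_n$ minimal series of $\mathfrak{sl}_n$-type.) *)

theory Defs
  imports "HOL-Complex_Analysis.Complex_Analysis"
begin

section \<open>The basis labels and the character\<close>

text \<open>Parts are indexed from \<open>0\<close>: the \<open>j\<close>-th part of \<open>\<mu>\<close> in the usual numbering is \<open>\<mu> (j - 1)\<close>.
  A weakly decreasing integer sequence with finitely many nonzero terms is nonnegative,
  so the values may be taken in \<open>nat\<close>.\<close>

definition fin_partitions :: "(nat \<Rightarrow> nat) set" where
  "fin_partitions = {\<mu>. antimono \<mu> \<and> finite {j. \<mu> j \<noteq> 0}}"

definition partition_size :: "(nat \<Rightarrow> nat) \<Rightarrow> nat" where
  "partition_size \<mu> = (\<Sum>j | \<mu> j \<noteq> 0. \<mu> j)"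

definition partition_tuples :: "nat \<Rightarrow> (nat \<Rightarrow> nat) \<Rightarrow> (nat \<Rightarrow> nat) \<Rightarrow> (nat \<Rightarrow> nat \<Rightarrow> nat) set" where
  "partition_tuples n a b =
     {\<Lambda> \<in> {1..n} \<rightarrow>\<^sub>E fin_partitions.
        \<forall>i\<in>{1..n}. \<forall>j.
          int (\<Lambda> i j) \<ge> int (\<Lambda> (if i = n then 1 else i + 1) (j + b i)) - int (a i)}"

text \<open>Infinite sums and products of formal series are taken in the metric topology
  of \<open>fps\<close> and \<open>fls\<close>, i.e. with coefficients stabilising. All those below converge, since only
  finitely many terms contribute to a given power of \<open>q\<close>.\<close>

definition module_character :: "nat \<Rightarrow> (nat \<Rightarrow> nat) \<Rightarrow> (nat \<Rightarrow> nat) \<Rightarrow> rat fps" where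
  "module_character n a b =
     (\<Sum>\<^sub>\<infinity>\<Lambda>\<in>partition_tuples n a b. fps_X ^ (\<Sum>i=1..n. partition_size (\<Lambda> i)))"

definition q_infty :: "rat fps" where
  "q_infty = prodinf (\<lambda>i. 1 - fps_X ^ Suc i)"

section \<open>Classical weights of type \<open>A\<close>\<close>

text \<open>Classical weights of \<open>sl\<^sub>n\<close> are realised as vectors \<open>x\<close> with coordinates \<open>x 1, \<dots>, x n\<close>
  of sum zero, and \<open>x k = 0\<close> for all other \<open>k\<close>; the invariant form is the standard
  scalar product.\<close>

definition weight_form :: "nat \<Rightarrow> (nat \<Rightarrow> rat) \<Rightarrow> (nat \<Rightarrow> rat) \<Rightarrow> rat" where
  "weight_form n x y = (\<Sum>k=1..n. x k * y k)"

definition simple_root :: "nat \<Rightarrow> nat \<Rightarrow> rat" where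
  "simple_root i = (\<lambda>k. if k = i then 1 else if k = i + 1 then -1 else 0)"

definition root_lattice :: "nat \<Rightarrow> (nat \<Rightarrow> rat) set" where
  "root_lattice n = {\<alpha>. \<exists>c :: nat \<Rightarrow> int. \<alpha> = (\<lambda>k. \<Sum>i=1..n-1. of_int (c i) * simple_root i k)}"

text \<open>The orthogonal projection of \<open>\<epsilon>\<^sub>1 + \<dots> + \<epsilon>\<^sub>i\<close> to the sum-zero hyperplane. For \<open>i = 0\<close> and
  \<open>i = n\<close> it is zero, as it should be for the classical part of \<open>\<omega>\<^sub>0 = \<omega>\<^sub>n\<close>.\<close>

definition fund_weight :: "nat \<Rightarrow> nat \<Rightarrow> nat \<Rightarrow> rat" where
  "fund_weight n i = (\<lambda>k. if k \<in> {1..n} then (if k \<le> i then 1 else 0) - of_nat i / of_nat n else 0)"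

definition weyl_vector :: "nat \<Rightarrow> nat \<Rightarrow> rat" where
  "weyl_vector n = (\<lambda>k. \<Sum>i=0..n-1. fund_weight n i k)"

text \<open>With the inverse, the basis vector \<open>\<epsilon>\<^sub>i\<close> is sent to \<open>\<epsilon>\<^bsub>\<sigma> i\<^esub>\<close>, so this is a left action.\<close>

definition weyl_act :: "(nat \<Rightarrow> nat) \<Rightarrow> (nat \<Rightarrow> rat) \<Rightarrow> nat \<Rightarrow> rat" where
  "weyl_act \<sigma> x = (\<lambda>k. x (inv \<sigma> k))"

definition perm_length :: "nat \<Rightarrow> (nat \<Rightarrow> nat) \<Rightarrow> nat" where
  "perm_length n \<sigma> =
     (LEAST l. \<exists>w. length w = l \<and> set w \<subseteq> {1..n-1} \<and>
                   \<sigma> = foldr (\<lambda>i \<tau>. Transposition.transpose i (i + 1) \<circ> \<tau>) w id)"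

section \<open>The alternating sum\<close>

definition theta_exponent ::
    "nat \<Rightarrow> int \<Rightarrow> int \<Rightarrow> (nat \<Rightarrow> rat) \<Rightarrow> (nat \<Rightarrow> rat) \<Rightarrow> (nat \<Rightarrow> nat) \<Rightarrow> (nat \<Rightarrow> rat) \<Rightarrow> rat" where
  "theta_exponent n p' p \<eta> \<xi> \<sigma> \<alpha> =
     (let Y = (\<lambda>k. \<eta> k + weyl_vector n k);
          X = (\<lambda>k. \<xi> k + weyl_vector n k)
      in of_int p' * of_int p / 2 * weight_form n \<alpha> \<alpha>
         + weight_form n (\<lambda>k. of_int p' * weyl_act \<sigma> X k - of_int p * Y k) \<alpha>
         + weight_form n (\<lambda>k. X k - weyl_act \<sigma> X k) Y)"

text \<open>The exponent is an integer for integral weights (see \<open>theta_exponent_Ints\<close>),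
  so \<open>floor\<close> is only a conversion from \<open>rat\<close> to \<open>int\<close>.\<close>

definition chi_bar :: "nat \<Rightarrow> int \<Rightarrow> int \<Rightarrow> (nat \<Rightarrow> rat) \<Rightarrow> (nat \<Rightarrow> rat) \<Rightarrow> rat fls" where
  "chi_bar n p' p \<eta> \<xi> =
     1 / fps_to_fls q_infty ^ (n - 1) *
     (\<Sum>\<sigma> | \<sigma> permutes {1..n}. (-1) ^ perm_length n \<sigma> *
        (\<Sum>\<^sub>\<infinity>\<alpha>\<in>root_lattice n. fls_X_intpow \<lfloor>theta_exponent n p' p \<eta> \<xi> \<sigma> \<alpha>\<rfloor>))"

definition weight_of :: "nat \<Rightarrow> (nat \<Rightarrow> nat) \<Rightarrow> nat \<Rightarrow> rat" where
  "weight_of n c = (\<lambda>k. \<Sum>i=1..n. of_nat (c i) * fund_weight n i k)"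

section \<open>Integrality of the exponent\<close>

lemma weight_form_Ints:
  assumes v: "\<And>k. k \<in> {1..n} \<Longrightarrow> v k \<in> \<int>" and s: "(\<Sum>k=1..n. v k) = 0"
    and y: "\<And>k l. k \<in> {1..n} \<Longrightarrow> l \<in> {1..n} \<Longrightarrow> y k - y l \<in> \<int>"
  shows "weight_form n v y \<in> \<int>"
proof -
  have "weight_form n v y = (\<Sum>k=1..n. v k * (y k - y 1)) + (\<Sum>k=1..n. v k) * y 1"
    by (simp add: weight_form_def algebra_simps sum_subtractf sum_distrib_right sum_distrib_left)
  also have "\<dots> = (\<Sum>k=1..n. v k * (y k - y 1))" unfolding s by simp
  also have "\<dots> \<in> \<int>" by (intro Ints_sum Ints_mult v y) auto
  finally show ?thesis .
qed

lemma root_lattice_sum: "\<alpha> \<in> root_lattice n \<Longrightarrow> (\<Sum>k=1..n. \<alpha> k) = 0"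
proof -
  assume "\<alpha> \<in> root_lattice n"
  then obtain c :: "nat \<Rightarrow> int" where c: "\<alpha> = (\<lambda>k. \<Sum>i=1..n-1. of_int (c i) * simple_root i k)"
    by (auto simp: root_lattice_def)
  have r: "(\<Sum>k=1..n. simple_root i k) = 0" if "i \<in> {1..n-1}" for i
  proof -
    have "(\<Sum>k=1..n. simple_root i k)
        = (\<Sum>k=1..n. (if k = i then 1 else 0) - (if k = i + 1 then 1 else 0))"
      by (intro sum.cong) (auto simp: simple_root_def)
    also have "\<dots> = 0" using that by (subst sum_subtractf) (auto simp: sum.delta)
    finally show ?thesis .
  qed
  show ?thesis unfolding c
    by (subst sum.swap) (use r in \<open>auto simp flip: sum_distrib_left intro!: sum.neutral\<close>)
qed

lemma root_lattice_Ints: "\<alpha> \<in> root_lattice n \<Longrightarrow> \<alpha> k \<in> \<int>"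
  unfolding root_lattice_def simple_root_def by (auto intro!: Ints_sum Ints_mult)

lemma half_norm_Ints:
  assumes "\<alpha> \<in> root_lattice n"
  shows "weight_form n \<alpha> \<alpha> / 2 \<in> \<int>"
proof -
  have "weight_form n \<alpha> \<alpha> / 2 = (\<Sum>k=1..n. (\<alpha> k * \<alpha> k - \<alpha> k) / 2)"
    using root_lattice_sum[OF assms]
    by (simp add: weight_form_def sum_subtractf flip: sum_divide_distrib)
  also have "\<dots> \<in> \<int>"
  proof (intro Ints_sum)
    fix k
    obtain z :: int where z: "\<alpha> k = of_int z"
      using root_lattice_Ints[OF assms] by (auto elim: Ints_cases)
    have "even (z * z - z)" by simp
    then obtain m where "z * z - z = 2 * m" by blast
    then have "of_int (z * z - z) = (2 * of_int m :: rat)" by simp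
    then have "(\<alpha> k * \<alpha> k - \<alpha> k) / 2 = of_int m" unfolding z by simp
    then show "(\<alpha> k * \<alpha> k - \<alpha> k) / 2 \<in> \<int>" by simp
  qed
  finally show ?thesis .
qed

lemma fund_weight_diff_Ints:
  "k \<in> {1..n} \<Longrightarrow> l \<in> {1..n} \<Longrightarrow> fund_weight n i k - fund_weight n i l \<in> \<int>"
  by (auto simp: fund_weight_def)

lemma theta_exponent_Ints:
  assumes \<sigma>: "\<sigma> permutes {1..n}" and \<alpha>: "\<alpha> \<in> root_lattice n"
  shows "theta_exponent n p' p (weight_of n a) (weight_of n b) \<sigma> \<alpha> \<in> \<int>"
proof -
  define W where "W = (\<lambda>c k. weight_of n c k + weyl_vector n k)"
  have W: "W c k - W c l \<in> \<int>" if "k \<in> {1..n}" "l \<in> {1..n}" for c k l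
  proof -
    have "W c k - W c l = (\<Sum>i=1..n. of_nat (c i) * (fund_weight n i k - fund_weight n i l))
        + (\<Sum>i=0..n-1. fund_weight n i k - fund_weight n i l)"
      by (simp add: W_def weight_of_def weyl_vector_def sum_subtractf algebra_simps)
    also have "\<dots> \<in> \<int>"
      by (intro Ints_add Ints_sum Ints_mult fund_weight_diff_Ints that) auto
    finally show ?thesis .
  qed
  have inv: "inv \<sigma> permutes {1..n}" using \<sigma> by (rule permutes_inv)
  have mem: "inv \<sigma> k \<in> {1..n}" if "k \<in> {1..n}" for k
    using permutes_in_image[OF inv] that by blast
  have A: "of_int p' * of_int p / 2 * weight_form n \<alpha> \<alpha> \<in> \<int>"
    using Ints_mult[OF Ints_of_int[of "p' * p"] half_norm_Ints[OF \<alpha>]] by simp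
  have B: "weight_form n (\<lambda>k. of_int p' * weyl_act \<sigma> (W b) k - of_int p * W a k) \<alpha> \<in> \<int>"
  proof -
    have "weight_form n \<alpha> (\<lambda>k. of_int p' * weyl_act \<sigma> (W b) k - of_int p * W a k) \<in> \<int>"
    proof (rule weight_form_Ints)
      fix k l assume kl: "k \<in> {1..n}" "l \<in> {1..n}"
      have "of_int p' * weyl_act \<sigma> (W b) k - of_int p * W a k -
            (of_int p' * weyl_act \<sigma> (W b) l - of_int p * W a l)
          = of_int p' * (W b (inv \<sigma> k) - W b (inv \<sigma> l)) - of_int p * (W a k - W a l)"
        by (simp add: weyl_act_def algebra_simps)
      also have "\<dots> \<in> \<int>" using kl by (intro Ints_diff Ints_mult W mem) auto
      finally show "of_int p' * weyl_act \<sigma> (W b) k - of_int p * W a k -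
            (of_int p' * weyl_act \<sigma> (W b) l - of_int p * W a l) \<in> \<int>" .
    qed (use \<alpha> root_lattice_sum root_lattice_Ints in auto)
    then show ?thesis by (simp add: weight_form_def mult.commute)
  qed
  have C: "weight_form n (\<lambda>k. W b k - weyl_act \<sigma> (W b) k) (W a) \<in> \<int>"
  proof (rule weight_form_Ints)
    show "W b k - weyl_act \<sigma> (W b) k \<in> \<int>" if "k \<in> {1..n}" for k
      using W[OF that mem[OF that]] by (simp add: weyl_act_def)
    have "(\<Sum>k=1..n. W b (inv \<sigma> k)) = (\<Sum>k=1..n. W b k)"
      using sum.permute[OF inv, of "W b"] by (simp add: o_def)
    then show "(\<Sum>k=1..n. W b k - weyl_act \<sigma> (W b) k) = 0"
      by (simp add: weyl_act_def sum_subtractf)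
  qed (use W in auto)
  show ?thesis using Ints_add[OF Ints_add[OF A B] C]
    by (simp add: theta_exponent_def W_def Let_def)
qed

end

theory Submission
  imports Defs
begin

text \<open>The proof is a reflection argument in the style of Lindstroem, Gessel and Viennot, on a cylinder.

  The boundary of a partition is a lattice path: a function \<open>h\<close> on the integers with steps \<open>0\<close>
  and \<open>1\<close>, equal to a constant \<open>x\<close> far to the left and to \<open>t + y\<close> far to the right. The pair
  \<open>(x, y)\<close> says where the corner of the quadrant is placed, and the size of the partition is the area
  between the path and this corner (\<open>area_path_of\<close>). Place the corner of the \<open>i\<close>-th partition
  according to the \<open>i\<close>-th coordinates \<open>X i\<close>, \<open>Y i\<close> of the two shifted weights \<open>\<xi> + \<rho>\<close> and
  \<open>\<eta> + \<rho>\<close>. Then the inequality between two consecutive partitions says precisely that the second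
  path runs strictly below the first (\<open>path_of_less_iff\<close>), and the last, cyclic, inequality says that
  a translate of the first path runs strictly below the last one. So the character counts families
  of \<open>n\<close> paths which, together with all translates by multiples of one fixed vector, do not meet
  (\<open>card_no_meeting\<close>).

  On the other side, a term of the alternating sum is indexed by a permutation \<open>\<sigma>\<close> and a root lattice
  vector \<open>\<alpha>\<close>. It stands for families of arbitrary paths with the same right ends \<open>Y j\<close>, whose left
  ends are moved to \<open>X (inv \<sigma> j) + p * \<alpha> j\<close>: the factor \<open>1 / (q)\<^sub>\<infinity> ^ n\<close> counts the \<open>n\<close>
  paths by area, and the exponent of the theta series is the constant which has to be added to the
  area to make it comparable for different left ends. Exchanging the initial parts of two strands at
  a point where they meet multiplies \<open>\<sigma>\<close> by a transposition, hence reverses the sign, and it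
  preserves area plus exponent (\<open>pair_conservation\<close>). This cancels all families with a meeting
  (\<open>sum_sign_meeting_eq_0\<close>). A family without a meeting has its strands in the same order at both
  ends, and this forces \<open>\<sigma> = id\<close> and \<open>\<alpha> = 0\<close> (\<open>no_meeting_imp_trivial\<close>).

  The translation vector has a horizontal component \<open>p' - p\<close>, so the time of a meeting is not
  invariant under the translations and cannot serve to single out a first meeting. Instead the meeting point and the two strands are picked by a
  choice function from data which the exchange does not change: the set of all meeting points, and
  the set of labels of the strands through the chosen point. This makes the exchange an involution.\<close>

section \<open>Euler's product\<close>

lemma partition_size_conv_sum:
  assumes "\<And>j. j \<ge> K \<Longrightarrow> \<mu> j = 0"
  shows "partition_size \<mu> = (\<Sum>j<K. \<mu> j)"
  unfolding partition_size_def
  by (intro sum.mono_neutral_left) (use assms in \<open>auto intro: ccontr simp: not_less\<close>)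

lemma fin_partitions_bound:
  assumes "\<mu> \<in> fin_partitions"
  obtains K where "\<And>j. j \<ge> K \<Longrightarrow> \<mu> j = 0"
proof -
  have "finite {j. \<mu> j \<noteq> 0}" using assms by (auto simp: fin_partitions_def)
  then obtain K where "\<forall>j\<in>{j. \<mu> j \<noteq> 0}. j < K"
    using finite_nat_set_iff_bounded by blast
  with that[of K] show thesis by (meson mem_Collect_eq not_less)
qed

definition partitions_le :: "nat \<Rightarrow> nat \<Rightarrow> (nat \<Rightarrow> nat) set" where
  "partitions_le k m = {\<mu>. antimono \<mu> \<and> (\<forall>j\<ge>k. \<mu> j = 0) \<and> (\<Sum>j<k. \<mu> j) = m}"

lemma finite_partitions_le: "finite (partitions_le k m)"
proof (rule finite_subset)
  show "partitions_le k m \<subseteq> {f. \<forall>j. (j \<in> {..<k} \<longrightarrow> f j \<in> {..m}) \<and> (j \<notin> {..<k} \<longrightarrow> f j = 0)}"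
    by (auto simp: partitions_le_def intro!: member_le_sum)
qed (rule finite_set_of_finite_funs; simp)

lemma fin_partitions_eq_partitions_le:
  assumes "m \<le> k"
  shows "{\<mu>\<in>fin_partitions. partition_size \<mu> = m} = partitions_le k m"
proof (intro equalityI subsetI)
  fix \<mu> assume "\<mu> \<in> {\<mu>\<in>fin_partitions. partition_size \<mu> = m}"
  then have \<mu>: "\<mu> \<in> fin_partitions" "partition_size \<mu> = m" by auto
  then have anti: "antimono \<mu>" by (auto simp: fin_partitions_def)
  obtain K where K: "\<And>j. j \<ge> K \<Longrightarrow> \<mu> j = 0" using fin_partitions_bound \<mu> by blast
  have z: "\<mu> j = 0" if j: "j \<ge> k" for j
  proof (rule ccontr)
    assume nz: "\<mu> j \<noteq> 0"
    then have "j < K" using K by (meson not_less)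
    have "Suc j = (\<Sum>i\<le>j. 1)" by simp
    also have "\<dots> \<le> (\<Sum>i\<le>j. \<mu> i)"
      by (intro sum_mono) (use anti nz in \<open>metis One_nat_def Suc_leI antimonoD atMost_iff le_zero_eq neq0_conv\<close>)
    also have "\<dots> \<le> (\<Sum>i<K. \<mu> i)" by (intro sum_mono2) (use \<open>j < K\<close> in auto)
    also have "\<dots> = m" using partition_size_conv_sum[of K \<mu>, OF K] \<mu> by simp
    finally show False using j assms by simp
  qed
  then show "\<mu> \<in> partitions_le k m"
    using partition_size_conv_sum[of k \<mu>] \<mu> anti by (auto simp: partitions_le_def)
next
  fix \<mu> assume "\<mu> \<in> partitions_le k m"
  then have \<mu>: "antimono \<mu>" "\<And>j. j \<ge> k \<Longrightarrow> \<mu> j = 0" "(\<Sum>j<k. \<mu> j) = m"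
    by (auto simp: partitions_le_def)
  have "{j. \<mu> j \<noteq> 0} \<subseteq> {..<k}" using \<mu>(2) by (auto intro: ccontr simp: not_less)
  then have "finite {j. \<mu> j \<noteq> 0}" by (rule finite_subset) simp
  then show "\<mu> \<in> {\<mu>\<in>fin_partitions. partition_size \<mu> = m}"
    using \<mu> partition_size_conv_sum[of k \<mu>] by (auto simp: fin_partitions_def)
qed

text \<open>If the last of \<open>k + 1\<close> admissible parts is nonzero, then a full column of height \<open>k + 1\<close> can
  be removed.\<close>

lemma card_partitions_le_Suc:
  "card (partitions_le (Suc k) m) = card (partitions_le k m) +
     (if Suc k \<le> m then card (partitions_le (Suc k) (m - Suc k)) else 0)"
proof -
  let ?P = "partitions_le (Suc k) m"
  let ?A = "{\<mu>\<in>?P. \<mu> k = 0}" and ?B = "{\<mu>\<in>?P. \<mu> k \<noteq> 0}"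
  have fin: "finite ?P" by (rule finite_partitions_le)
  have "?P = ?A \<union> ?B" by auto
  then have "card ?P = card ?A + card ?B"
    using card_Un_disjoint[of ?A ?B] fin by (auto simp: disjoint_iff)
  also have "?A = partitions_le k m"
    by (auto simp: partitions_le_def) (metis le_antisym not_less_eq_eq)
  also have "card ?B = (if Suc k \<le> m then card (partitions_le (Suc k) (m - Suc k)) else 0)"
  proof -
    have ge: "(\<Sum>j<Suc k. \<mu> j) = (\<Sum>j<Suc k. \<mu> j - 1) + Suc k" "\<mu> j \<ge> 1"
      if "antimono \<mu>" "\<mu> k \<noteq> 0" "j \<le> k" for \<mu> :: "nat \<Rightarrow> nat" and j
    proof -
      have 1: "\<mu> j \<ge> 1" if "j \<le> k" for j
        using antimonoD[OF \<open>antimono \<mu>\<close> that] \<open>\<mu> k \<noteq> 0\<close> by simp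
      then show "\<mu> j \<ge> 1" using that by simp
      have "\<mu> i = (\<mu> i - 1) + 1" if "i \<in> {..<Suc k}" for i
        using 1[of i] that by simp
      then have "(\<Sum>j<Suc k. \<mu> j) = (\<Sum>j<Suc k. (\<mu> j - 1) + 1)"
        by (rule sum.cong[OF refl])
      then show "(\<Sum>j<Suc k. \<mu> j) = (\<Sum>j<Suc k. \<mu> j - 1) + Suc k"
        by (simp only: sum.distrib) simp
    qed
    show ?thesis
    proof (cases "Suc k \<le> m")
      case False
      have "\<mu> \<notin> ?B" for \<mu>
      proof
        assume "\<mu> \<in> ?B"
        then have "antimono \<mu>" "\<mu> k \<noteq> 0" "(\<Sum>j<Suc k. \<mu> j) = m"
          by (simp_all add: partitions_le_def del: sum.lessThan_Suc)
        then show False using ge(1)[of \<mu> k] False by linarith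
      qed
      then have "?B = {}" by blast
      then show ?thesis using False by (simp only: card.empty if_False)
    next
      case True
      have "bij_betw (\<lambda>\<mu> j. \<mu> j - 1) ?B (partitions_le (Suc k) (m - Suc k))"
      proof (rule bij_betw_byWitness[where f' = "\<lambda>\<mu> j. if j \<le> k then \<mu> j + 1 else 0"])
        show "\<forall>\<mu>\<in>?B. (\<lambda>j. if j \<le> k then (\<mu> j - 1) + 1 else 0) = \<mu>"
        proof (intro ballI ext)
          fix \<mu> j assume "\<mu> \<in> ?B"
          then show "(if j \<le> k then (\<mu> j - 1) + 1 else 0) = \<mu> j"
            using ge(2)[of \<mu> j] by (auto simp: partitions_le_def not_le Suc_le_eq)
        qed
        show "\<forall>\<mu>\<in>partitions_le (Suc k) (m - Suc k). (\<lambda>j. (if j \<le> k then \<mu> j + 1 else 0) - 1) = \<mu>"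
          by (auto simp: partitions_le_def fun_eq_iff)
        show "(\<lambda>\<mu> j. \<mu> j - 1) ` ?B \<subseteq> partitions_le (Suc k) (m - Suc k)"
        proof (intro image_subsetI)
          fix \<mu> assume "\<mu> \<in> ?B"
          then have \<mu>: "antimono \<mu>" "\<mu> k \<noteq> 0" "\<And>j. j \<ge> Suc k \<Longrightarrow> \<mu> j = 0" "(\<Sum>j<Suc k. \<mu> j) = m"
            by (auto simp: partitions_le_def simp del: sum.lessThan_Suc)
          have "antimono (\<lambda>j. \<mu> j - 1)"
            using \<mu>(1) by (auto simp: antimono_def intro!: diff_le_mono)
          with \<mu> ge(1)[OF \<mu>(1,2) le_refl]
          show "(\<lambda>j. \<mu> j - 1) \<in> partitions_le (Suc k) (m - Suc k)"
            by (auto simp: partitions_le_def simp del: sum.lessThan_Suc)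
        qed
        show "(\<lambda>\<mu> j. if j \<le> k then \<mu> j + 1 else 0) ` partitions_le (Suc k) (m - Suc k) \<subseteq> ?B"
        proof (intro image_subsetI)
          fix \<mu> assume "\<mu> \<in> partitions_le (Suc k) (m - Suc k)"
          then have \<mu>: "antimono \<mu>" "\<And>j. j \<ge> Suc k \<Longrightarrow> \<mu> j = 0" "(\<Sum>j<Suc k. \<mu> j) = m - Suc k"
            by (auto simp: partitions_le_def simp del: sum.lessThan_Suc)
          have "(\<Sum>j<Suc k. if j \<le> k then \<mu> j + 1 else 0) = (\<Sum>j<Suc k. \<mu> j + 1)"
            by (intro sum.cong) auto
          also have "\<dots> = m" using \<mu>(3) True by (simp only: sum.distrib) simp
          finally have "(\<Sum>j<Suc k. if j \<le> k then \<mu> j + 1 else 0) = m" .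
          moreover have "antimono (\<lambda>j. if j \<le> k then \<mu> j + 1 else 0)"
            using \<mu>(1) by (auto simp: antimono_def)
          ultimately show "(\<lambda>j. if j \<le> k then \<mu> j + 1 else 0) \<in> ?B"
            by (auto simp: partitions_le_def simp del: sum.lessThan_Suc)
        qed
      qed
      then show ?thesis using True by (simp add: bij_betw_same_card)
    qed
  qed
  finally show ?thesis .
qed

definition partition_series :: "rat fps" where
  "partition_series = Abs_fps (\<lambda>m. of_nat (card {\<mu>\<in>fin_partitions. partition_size \<mu> = m}))"

lemma partitions_le_series:
  "Abs_fps (\<lambda>m. of_nat (card (partitions_le k m))) * (\<Prod>i<k. 1 - fps_X ^ Suc i) = (1 :: rat fps)"
proof (induction k)
  case 0
  have "partitions_le 0 m = (if m = 0 then {\<lambda>_. 0} else {})" for m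
    by (auto simp: partitions_le_def antimono_def fun_eq_iff)
  then show ?case by (auto simp: fps_eq_iff)
next
  case (Suc k)
  let ?F = "\<lambda>k. Abs_fps (\<lambda>m. of_nat (card (partitions_le k m))) :: rat fps"
  have "?F (Suc k) = ?F k + ?F (Suc k) * fps_X ^ Suc k"
  proof (rule fps_ext)
    fix m
    show "fps_nth (?F (Suc k)) m = fps_nth (?F k + ?F (Suc k) * fps_X ^ Suc k) m"
      by (simp add: card_partitions_le_Suc[of k m] fps_X_power_mult_right_nth del: power_Suc)
  qed
  then have *: "?F (Suc k) * (1 - fps_X ^ Suc k) = ?F k"
    by (simp add: algebra_simps del: power_Suc)
  have "?F (Suc k) * (\<Prod>i<Suc k. 1 - fps_X ^ Suc i) =
      (?F (Suc k) * (1 - fps_X ^ Suc k)) * (\<Prod>i<k. 1 - fps_X ^ Suc i)"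
    by (simp only: prod.lessThan_Suc mult_ac)
  also have "\<dots> = 1" unfolding * by (rule Suc.IH)
  finally show ?case .
qed

text \<open>The factors with index at least \<open>m\<close> do not reach the coefficient of \<open>q ^ m\<close>.\<close>

lemma prod_one_minus_X_nth:
  "m \<le> k \<Longrightarrow> fps_nth (\<Prod>i<k. 1 - fps_X ^ Suc i :: rat fps) m = fps_nth (\<Prod>i<m. 1 - fps_X ^ Suc i) m"
proof (induction k rule: dec_induct)
  case (step k)
  have "(\<Prod>i<Suc k. 1 - fps_X ^ Suc i :: rat fps) =
      (\<Prod>i<k. 1 - fps_X ^ Suc i) - (\<Prod>i<k. 1 - fps_X ^ Suc i) * fps_X ^ Suc k"
    by (simp add: algebra_simps)
  then show ?case using step by (simp add: fps_X_power_mult_right_nth del: power_Suc)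
qed simp

lemma q_infty_nth: "m \<le> k \<Longrightarrow> fps_nth q_infty m = fps_nth (\<Prod>i<k. 1 - fps_X ^ Suc i) m"
proof -
  assume mk: "m \<le> k"
  let ?Q = "Abs_fps (\<lambda>m. fps_nth (\<Prod>i<m. 1 - fps_X ^ Suc i) m) :: rat fps"
  have "fps_nth ?Q 0 = 1" by simp
  then have "?Q \<noteq> 0" by (metis fps_zero_nth zero_neq_one)
  moreover have "(\<lambda>N. \<Prod>i\<le>N. 1 - fps_X ^ Suc (i + 0)) \<longlonglongrightarrow> ?Q"
  proof (rule tendsto_fpsI)
    fix m
    show "\<forall>\<^sub>F N in sequentially. fps_nth (\<Prod>i\<le>N. 1 - fps_X ^ Suc (i + 0)) m = fps_nth ?Q m"
      using eventually_ge_at_top[of m]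
    proof eventually_elim
      case (elim N)
      then show ?case using prod_one_minus_X_nth[of m "Suc N"]
        by (simp only: lessThan_Suc_atMost add_0_right fps_nth_Abs_fps)
    qed
  qed
  ultimately have "(\<lambda>i. 1 - fps_X ^ Suc i :: rat fps) has_prod ?Q"
    by (simp add: has_prod_def raw_has_prod_def)
  then have "q_infty = ?Q" unfolding q_infty_def by (rule has_prod_unique[symmetric])
  then have "fps_nth q_infty m = fps_nth ?Q m" by (rule arg_cong)
  then show ?thesis unfolding fps_nth_Abs_fps using prod_one_minus_X_nth[OF mk] by argo
qed

text \<open>In degree \<open>m\<close> both factors may be truncated: a partition of at most \<open>m\<close> has at most \<open>m\<close>
  parts, and the product stabilises. The truncated identity is \<open>partitions_le_series\<close>.\<close>

lemma partition_series_times_q_infty: "partition_series * q_infty = 1"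
proof (rule fps_ext)
  fix m
  have "fps_nth (partition_series * q_infty) m =
      fps_nth (Abs_fps (\<lambda>j. of_nat (card (partitions_le m j))) * (\<Prod>i<m. 1 - fps_X ^ Suc i)) m"
    unfolding fps_mult_nth
  proof (rule sum.cong)
    fix i assume "i \<in> {0..m}"
    then show "fps_nth partition_series i * fps_nth q_infty (m - i) =
        fps_nth (Abs_fps (\<lambda>j. of_nat (card (partitions_le m j)))) i *
        fps_nth (\<Prod>i<m. 1 - fps_X ^ Suc i) (m - i)"
      using fin_partitions_eq_partitions_le[of i m] q_infty_nth[of "m - i" m]
      by (simp add: partition_series_def)
  qed simp
  then show "fps_nth (partition_series * q_infty) m = fps_nth 1 m" by (simp only: partitions_le_series)
qed

lemma power_series_counts_tuples:
  fixes sz :: "'a \<Rightarrow> nat" and P :: "'a set" and I :: "'b set"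
  assumes "finite I" and fin: "\<And>m. finite {x\<in>P. sz x = m}"
  defines "T \<equiv> \<lambda>I m. {f \<in> I \<rightarrow>\<^sub>E P. (\<Sum>i\<in>I. sz (f i)) = m}"
  shows "finite (T I m) \<and>
    fps_nth (Abs_fps (\<lambda>m. of_nat (card {x\<in>P. sz x = m})) ^ card I) m = (of_nat (card (T I m)) :: 'c :: comm_ring_1)"
  using assms(1)
proof (induction I arbitrary: m rule: finite_induct)
  case empty
  have "T {} m = (if m = 0 then {\<lambda>_. undefined} else {})" by (auto simp: T_def)
  then show ?case by auto
next
  case (insert x I m)
  let ?G = "Abs_fps (\<lambda>m. of_nat (card {x\<in>P. sz x = m})) :: 'c fps"
  let ?S = "SIGMA k:{0..m}. {y\<in>P. sz y = k} \<times> T I (m - k)"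
  have bij: "bij_betw (\<lambda>(k, y, g). g(x := y)) ?S (T (insert x I) m)"
    unfolding bij_betw_def
  proof
    show "inj_on (\<lambda>(k, y, g). g(x := y)) ?S"
    proof (rule inj_onI)
      fix u v assume uv: "u \<in> ?S" "v \<in> ?S" "(\<lambda>(k, y, g). g(x := y)) u = (\<lambda>(k, y, g). g(x := y)) v"
      obtain y g where u: "u = (sz y, y, g)" "g \<in> T I (m - sz y)" using uv(1) by auto
      obtain y' g' where v: "v = (sz y', y', g')" "g' \<in> T I (m - sz y')" using uv(2) by auto
      have "g x = undefined" "g' x = undefined"
        using u v insert.hyps by (auto simp: T_def PiE_def extensional_def)
      moreover have "g(x := y) = g'(x := y')" using uv(3) u v by simp
      ultimately have "y = y' \<and> g = g'"
        by (metis fun_upd_idem_iff fun_upd_same fun_upd_upd)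
      then show "u = v" using u v by simp
    qed
    show "(\<lambda>(k, y, g). g(x := y)) ` ?S = T (insert x I) m"
    proof (intro equalityI subsetI)
      fix f assume "f \<in> (\<lambda>(k, y, g). g(x := y)) ` ?S"
      then obtain y g where yg: "f = g(x := y)" "y \<in> P" "sz y \<le> m" "g \<in> T I (m - sz y)" by auto
      have "(\<Sum>i\<in>I. sz ((g(x := y)) i)) = (\<Sum>i\<in>I. sz (g i))"
        by (intro sum.cong refl) (use insert.hyps in auto)
      then show "f \<in> T (insert x I) m"
        using yg insert.hyps by (auto simp: T_def PiE_def extensional_def)
    next
      fix f assume f: "f \<in> T (insert x I) m"
      let ?g = "f(x := undefined)"
      have "(\<Sum>i\<in>I. sz (?g i)) = (\<Sum>i\<in>I. sz (f i))"
        by (intro sum.cong refl) (use insert.hyps in auto)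
      moreover have "sz (f x) + (\<Sum>i\<in>I. sz (f i)) = m" using f insert.hyps by (simp add: T_def)
      ultimately have "(sz (f x), f x, ?g) \<in> ?S"
        using f insert.hyps by (auto simp: T_def PiE_def extensional_def)
      moreover have "f = ?g(x := f x)" by simp
      ultimately show "f \<in> (\<lambda>(k, y, g). g(x := y)) ` ?S"
        by (intro image_eqI[where x = "(sz (f x), f x, ?g)"]) simp_all
    qed
  qed
  have finS: "finite ?S" using fin insert.IH by (intro finite_SigmaI) auto
  have "of_nat (card (T (insert x I) m)) = (of_nat (card ?S) :: 'c)"
    using bij_betw_same_card[OF bij] by simp
  also have "card ?S = (\<Sum>k=0..m. card {y\<in>P. sz y = k} * card (T I (m - k)))"
    using fin insert.IH by (subst card_SigmaI) (auto simp: card_cartesian_product)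
  also have "of_nat \<dots> = fps_nth (?G ^ card (insert x I)) m"
    using insert.hyps insert.IH by (simp add: fps_mult_nth)
  finally show ?case using bij_betw_finite[OF bij] finS by simp
qed

section \<open>Lengths and signs of permutations\<close>

definition adjacent_word :: "nat list \<Rightarrow> nat \<Rightarrow> nat" where
  "adjacent_word w = foldr (\<lambda>i \<tau>. Transposition.transpose i (i + 1) \<circ> \<tau>) w id"

lemma adjacent_word_simps [simp]:
  "adjacent_word [] = id"
  "adjacent_word (i # w) = Transposition.transpose i (i + 1) \<circ> adjacent_word w"
  by (simp_all add: adjacent_word_def)

lemma adjacent_word_append: "adjacent_word (v @ w) = adjacent_word v \<circ> adjacent_word w"
  by (induction v) (simp_all add: comp_assoc)

lemma sign_adjacent_word: "permutation (adjacent_word w) \<and> sign (adjacent_word w) = (-1) ^ length w"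
proof (induction w)
  case (Cons i w)
  have t: "permutation (Transposition.transpose i (i + 1))" by (rule permutation_swap_id)
  show ?case
    unfolding adjacent_word_simps using Cons permutation_compose[OF t] sign_compose[OF t]
    by (simp only: sign_swap_id) simp
qed (simp add: permutation_id sign_id)

text \<open>Conjugating by an adjacent transposition moves the right end of a transposition by one.\<close>

lemma transpose_eq_adjacent_word:
  assumes "1 \<le> i"
  shows "i + Suc d \<le> n \<Longrightarrow> \<exists>w. set w \<subseteq> {1..n-1} \<and> Transposition.transpose i (i + Suc d) = adjacent_word w"
proof (induction d)
  case 0
  then show ?case using assms by (intro exI[of _ "[i]"]) auto
next
  case (Suc d)
  then obtain w where w: "set w \<subseteq> {1..n-1}" "Transposition.transpose i (i + Suc d) = adjacent_word w"
    by auto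
  let ?s = "i + Suc d"
  have "Transposition.transpose i (i + Suc (Suc d)) =
      Transposition.transpose ?s (?s + 1) \<circ> (Transposition.transpose i ?s \<circ> Transposition.transpose ?s (?s + 1))"
    by (auto simp: fun_eq_iff Transposition.transpose_def)
  also have "\<dots> = adjacent_word ([?s] @ w @ [?s])"
    using w(2) by (simp only: adjacent_word_append) simp
  finally show ?case using w(1) Suc.prems by (intro exI[of _ "[?s] @ w @ [?s]"]) auto
qed

lemma permutes_eq_adjacent_word:
  assumes "\<sigma> permutes {1..n}"
  shows "\<exists>w. set w \<subseteq> {1..n-1} \<and> \<sigma> = adjacent_word w"
  using assms finite_atLeastAtMost[of 1 n]
proof (induction rule: permutes_induct)
  case id
  show ?case by (intro exI[of _ "[]"]) simp
next
  case (swap a b p)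
  then obtain w where w: "set w \<subseteq> {1..n-1}" "p = adjacent_word w" by auto
  have "\<exists>v. set v \<subseteq> {1..n-1} \<and> Transposition.transpose a b = adjacent_word v"
  proof (cases "a < b")
    case True
    then show ?thesis using transpose_eq_adjacent_word[of a "b - a - 1" n] swap by simp
  next
    case False
    then show ?thesis using transpose_eq_adjacent_word[of b "a - b - 1" n] swap
      by (simp add: transpose_commute)
  qed
  then obtain v where v: "set v \<subseteq> {1..n-1}" "Transposition.transpose a b = adjacent_word v" by blast
  show ?case using v w by (intro exI[of _ "v @ w"]) (simp add: adjacent_word_append)
qed

lemma minus_one_power_perm_length:
  assumes "\<sigma> permutes {1..n}"
  shows "(-1) ^ perm_length n \<sigma> = (of_int (sign \<sigma>) :: 'a :: ring_1)"
proof -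
  let ?P = "\<lambda>l. \<exists>w. length w = l \<and> set w \<subseteq> {1..n-1} \<and> \<sigma> = adjacent_word w"
  have "\<exists>l. ?P l" using permutes_eq_adjacent_word[OF assms] by blast
  then have "?P (LEAST l. ?P l)" by (rule LeastI_ex)
  also have "(LEAST l. ?P l) = perm_length n \<sigma>"
    by (simp only: perm_length_def adjacent_word_def)
  finally obtain w where "length w = perm_length n \<sigma>" "\<sigma> = adjacent_word w" by blast
  then show ?thesis using sign_adjacent_word[of w] by (metis of_int_1 of_int_minus of_int_power)
qed

section \<open>Partitions as lattice paths\<close>

text \<open>The pair \<open>(x, y)\<close> records both asymptotes and so the corner \<open>max x (t + y)\<close>, which is the path of
  the empty partition.\<close>

definition paths :: "int \<Rightarrow> int \<Rightarrow> (int \<Rightarrow> int) set" where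
  "paths x y = {h. (\<forall>t. h (t + 1) \<in> {h t, h t + 1}) \<and>
     (\<exists>T. \<forall>t\<le>T. h t = x) \<and> (\<exists>T. \<forall>t\<ge>T. h t = t + y)}"

definition area :: "int \<Rightarrow> int \<Rightarrow> (int \<Rightarrow> int) \<Rightarrow> int" where
  "area x y h = (\<Sum>t | h t \<noteq> max x (t + y). h t - max x (t + y))"

text \<open>The value \<open>j\<close> is counted once the path has passed the \<open>j\<close>-th row, which happens \<open>\<mu> j\<close> steps earlier
  than for the corner. By monotonicity of \<open>\<mu>\<close> the counted set is an initial segment, so membership
  in it is the comparison \<open>path_of_iff\<close>, from which all properties of the path are read off.\<close>

definition path_of :: "int \<Rightarrow> int \<Rightarrow> (nat \<Rightarrow> nat) \<Rightarrow> int \<Rightarrow> int" where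
  "path_of x y \<mu> t = x + int (card {j. int j < int (\<mu> j) + t + y - x})"

lemma pathsI:
  assumes "\<And>t. h (t + 1) \<in> {h t, h t + 1}" "\<exists>T. \<forall>t\<le>T. h t = x" "\<exists>T. \<forall>t\<ge>T. h t = t + y"
  shows "h \<in> paths x y"
  using assms by (simp only: paths_def mem_Collect_eq) blast

lemma paths_step_bounds:
  assumes "\<forall>t. h (t + 1) \<in> {h t, h t + (1::int)}" "s \<le> (t::int)"
  shows "h s \<le> h t" "h t \<le> h s + (t - s)"
proof -
  have "h s \<le> h (s + int d) \<and> h (s + int d) \<le> h s + int d" for d
  proof (induction d)
    case (Suc d)
    have "h (s + int d + 1) \<in> {h (s + int d), h (s + int d) + 1}" using assms(1) by blast
    then show ?case using Suc by (auto simp: algebra_simps)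
  qed simp
  from this[of "nat (t - s)"] show "h s \<le> h t" "h t \<le> h s + (t - s)" using assms(2) by auto
qed

lemma paths_bounds:
  assumes "h \<in> paths x y" "s \<le> t"
  shows "h s \<le> h t" "h t \<le> h s + (t - s)"
  using paths_step_bounds[of h s t] assms by (auto simp: paths_def)

lemma paths_ge:
  assumes "h \<in> paths x y"
  shows "h t \<ge> x" "h t \<ge> t + y"
proof -
  obtain T where T: "\<And>s. s \<le> T \<Longrightarrow> h s = x" using assms by (auto simp: paths_def)
  show "h t \<ge> x" using paths_bounds(1)[OF assms, of "min t T" t] T[of "min t T"] by simp
  obtain T where T: "\<And>s. s \<ge> T \<Longrightarrow> h s = s + y" using assms by (auto simp: paths_def)
  show "h t \<ge> t + y" using paths_bounds(2)[OF assms, of t "max t T"] T[of "max t T"] by simp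
qed

lemma path_of_iff:
  assumes \<mu>: "\<mu> \<in> fin_partitions"
  shows "int j < path_of x y \<mu> t - x \<longleftrightarrow> int j < int (\<mu> j) + t + y - x"
proof -
  let ?S = "{j. int j < int (\<mu> j) + t + y - x}"
  have anti: "antimono \<mu>" using \<mu> by (simp add: fin_partitions_def)
  have down: "i \<in> ?S" if "j \<in> ?S" "i \<le> j" for i j
    using that antimonoD[OF anti \<open>i \<le> j\<close>] by auto
  have "?S \<subseteq> {..nat (int (\<mu> 0) + t + y - x)}"
  proof
    fix j assume "j \<in> ?S"
    then show "j \<in> {..nat (int (\<mu> 0) + t + y - x)}" using antimonoD[OF anti, of 0 j] by auto
  qed
  then have fin: "finite ?S" by (rule finite_subset) simp
  have "j \<in> ?S \<longleftrightarrow> j < card ?S"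
  proof
    assume "j \<in> ?S"
    then have "{..j} \<subseteq> ?S" using down by blast
    then have "card {..j} \<le> card ?S" using fin by (rule card_mono[rotated])
    then show "j < card ?S" by simp
  next
    assume j: "j < card ?S"
    show "j \<in> ?S"
    proof (rule ccontr)
      assume "j \<notin> ?S"
      have "?S \<subseteq> {..<j}"
      proof
        fix i assume i: "i \<in> ?S"
        show "i \<in> {..<j}"
        proof (rule ccontr)
          assume "i \<notin> {..<j}"
          then have "j \<in> ?S" using down[OF i, of j] by simp
          with \<open>j \<notin> ?S\<close> show False ..
        qed
      qed
      then have "card ?S \<le> card {..<j}" by (intro card_mono) auto
      then show False using j by simp
    qed
  qed
  then show ?thesis by (simp add: path_of_def)
qed

lemma path_of_mem:
  assumes \<mu>: "\<mu> \<in> fin_partitions"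
  shows "path_of x y \<mu> \<in> paths x y"
proof -
  let ?h = "path_of x y \<mu>"
  have anti: "antimono \<mu>" and fin: "finite {j. \<mu> j \<noteq> 0}" using \<mu> by (simp_all add: fin_partitions_def)
  have ge: "?h t \<ge> x" for t by (simp add: path_of_def)
  have eqI: "?h t = z" if "z \<ge> x" "\<And>j. int j < z - x \<longleftrightarrow> int j < int (\<mu> j) + t + y - x" for t z
  proof (rule ccontr)
    assume "?h t \<noteq> z"
    then consider "?h t < z" | "z < ?h t" by linarith
    then show False
    proof cases
      case 1
      then show False using that(2)[of "nat (?h t - x)"] path_of_iff[OF \<mu>, of "nat (?h t - x)" x y t] ge[of t] by simp
    next
      case 2
      then show False using that(2)[of "nat (z - x)"] path_of_iff[OF \<mu>, of "nat (z - x)" x y t] that(1) by simp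
    qed
  qed
  have step: "?h (t + 1) \<in> {?h t, ?h t + 1}" for t
  proof -
    have "?h t \<le> ?h (t + 1)"
    proof (rule ccontr)
      assume "\<not> ?h t \<le> ?h (t + 1)"
      then show False using path_of_iff[OF \<mu>, of "nat (?h (t+1) - x)" x y t]
          path_of_iff[OF \<mu>, of "nat (?h (t+1) - x)" x y "t+1"] ge[of "t+1"] by simp
    qed
    moreover have "?h (t + 1) \<le> ?h t + 1"
    proof (rule ccontr)
      assume "\<not> ?h (t + 1) \<le> ?h t + 1"
      then show False using path_of_iff[OF \<mu>, of "nat (?h t - x)" x y t]
          path_of_iff[OF \<mu>, of "Suc (nat (?h t - x))" x y "t+1"] ge[of t]
          antimonoD[OF anti, of "nat (?h t - x)" "Suc (nat (?h t - x))"] by simp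
    qed
    ultimately show ?thesis by auto
  qed
  have left: "?h t = x" if "t \<le> x - y - int (\<mu> 0)" for t
  proof (rule eqI)
    show "int j < x - x \<longleftrightarrow> int j < int (\<mu> j) + t + y - x" for j
      using antimonoD[OF anti, of 0 j] that by simp
  qed simp
  obtain K where K: "\<And>j. j \<ge> K \<Longrightarrow> \<mu> j = 0"
    using fin_partitions_bound[OF \<mu>] by blast
  have right: "?h t = t + y" if "t \<ge> x - y + int K" for t
  proof (rule eqI)
    show "int j < t + y - x \<longleftrightarrow> int j < int (\<mu> j) + t + y - x" for j
      using K[of j] that by (cases "j \<ge> K") auto
  qed (use that in simp)
  have "\<exists>T. \<forall>t\<le>T. ?h t = x" using left by (intro exI allI impI)
  moreover have "\<exists>T. \<forall>t\<ge>T. ?h t = t + y" using right by (intro exI allI impI)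
  ultimately show ?thesis by (rule pathsI[of ?h, OF step])
qed

lemma path_of_surj:
  assumes h: "h \<in> paths x y"
  shows "\<exists>\<mu>\<in>fin_partitions. h = path_of x y \<mu>"
proof -
  obtain T where T: "\<And>s. s \<le> T \<Longrightarrow> h s = x" using h by (auto simp: paths_def)
  obtain T' where T': "\<And>s. s \<ge> T' \<Longrightarrow> h s = s + y" using h by (auto simp: paths_def)
  have ex: "\<exists>m::nat. \<forall>t. x + int j < h t \<longleftrightarrow> int j + x - y - int m < t" for j
  proof -
    let ?b = "int j + x - y"
    \<comment> \<open>The part is the number of steps by which the path rises above level \<open>x + j\<close> earlier
      than the corner does.\<close>
    define S where "S = {m::nat. \<not> x + int j < h (?b - int m)}"
    have "nat (?b - T) \<in> S" using T[of "?b - int (nat (?b - T))"] by (simp add: S_def)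
    define m where "m = (LEAST m. m \<in> S)"
    have m: "m \<in> S" "\<And>k. k < m \<Longrightarrow> k \<notin> S"
      unfolding m_def using \<open>nat (?b - T) \<in> S\<close> by (auto intro: LeastI dest: not_less_Least)
    have "x + int j < h t \<longleftrightarrow> ?b - int m < t" for t
    proof
      assume "x + int j < h t"
      then show "?b - int m < t"
        using m(1) paths_bounds(1)[OF h, of t "?b - int m"] by (force simp: S_def)
    next
      assume t: "?b - int m < t"
      show "x + int j < h t"
      proof (cases "t \<le> ?b")
        case True
        then show ?thesis using t m(2)[of "nat (?b - t)"] by (simp add: S_def)
      next
        case False
        then show ?thesis using paths_ge(2)[OF h, of t] by simp
      qed
    qed
    then show ?thesis by blast
  qed
  then obtain \<mu> :: "nat \<Rightarrow> nat" where \<mu>: "\<And>j t. x + int j < h t \<longleftrightarrow> int j + x - y - int (\<mu> j) < t"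
    by metis
  have "antimono \<mu>"
  proof (rule antimono_iff_le_Suc[THEN iffD2], intro allI)
    fix j
    let ?t = "int (Suc j) + x - y - int (\<mu> (Suc j)) + 1"
    have "x + int (Suc j) < h ?t" by (subst \<mu>) simp
    then have "x + int j < h (?t - 1)"
      using paths_bounds(2)[OF h, of "?t - 1" ?t] by simp
    then show "\<mu> (Suc j) \<le> \<mu> j" by (subst (asm) \<mu>) simp
  qed
  moreover have "{j. \<mu> j \<noteq> 0} \<subseteq> {..nat (h T' - x)}"
  proof
    fix j assume "j \<in> {j. \<mu> j \<noteq> 0}"
    then have *: "x + int j < h (int j + x - y)" by (subst \<mu>) simp
    then have "int j + x - y < T'" using T'[of "int j + x - y"] by linarith
    then have "h (int j + x - y) \<le> h T'" by (intro paths_bounds(1)[OF h]) simp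
    then show "j \<in> {..nat (h T' - x)}" using * by simp
  qed
  then have "finite {j. \<mu> j \<noteq> 0}" by (rule finite_subset) simp
  ultimately have mem: "\<mu> \<in> fin_partitions" by (simp add: fin_partitions_def)
  have iff: "int j < h t - x \<longleftrightarrow> int j < path_of x y \<mu> t - x" for j t
    using path_of_iff[OF mem, of j x y t] \<mu>[of j t] by linarith
  have "h = path_of x y \<mu>"
  proof (rule ext, rule ccontr)
    fix t assume ne: "h t \<noteq> path_of x y \<mu> t"
    have "h t \<ge> x" "path_of x y \<mu> t \<ge> x" using paths_ge(1)[OF h] by (auto simp: path_of_def)
    then show False using ne iff[of "nat (h t - x)" t] iff[of "nat (path_of x y \<mu> t - x)" t]
      by simp
  qed
  then show ?thesis using mem by blast
qed

lemma inj_on_path_of: "inj_on (path_of x y) fin_partitions"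
proof (rule inj_onI, rule ext)
  fix \<mu> \<nu> j assume *: "\<mu> \<in> fin_partitions" "\<nu> \<in> fin_partitions" "path_of x y \<mu> = path_of x y \<nu>"
  have "int j < int (\<mu> j) + t + y - x \<longleftrightarrow> int j < int (\<nu> j) + t + y - x" for t
    using path_of_iff[OF *(1), of j x y t] path_of_iff[OF *(2), of j x y t] *(3) by simp
  from this[of "int j + x - y - int (\<mu> j)"] this[of "int j + x - y - int (\<nu> j)"]
  show "\<mu> j = \<nu> j" by simp
qed

lemma area_eq_window:
  assumes "\<And>t. t \<le> M \<Longrightarrow> h t = max x (t + y)" "\<And>t. t > N \<Longrightarrow> h t = max x (t + y)"
  shows "area x y h = (\<Sum>t\<in>{M<..N}. h t - max x (t + y))"
  unfolding area_def
proof (rule sum.mono_neutral_left)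
  show "{t. h t \<noteq> max x (t + y)} \<subseteq> {M<..N}"
  proof
    fix t assume "t \<in> {t. h t \<noteq> max x (t + y)}"
    then show "t \<in> {M<..N}" using assms(1)[of t] assms(2)[of t] by fastforce
  qed
qed auto

lemma paths_agree_outside:
  assumes h: "h \<in> paths x y"
  shows "\<exists>M. \<forall>t\<le>M. h t = x \<and> t + y \<le> x" "\<exists>N. \<forall>t>N. h t = t + y \<and> x \<le> t + y"
proof -
  obtain T where T: "\<And>s. s \<le> T \<Longrightarrow> h s = x" using h by (auto simp: paths_def)
  obtain T' where T': "\<And>s. s \<ge> T' \<Longrightarrow> h s = s + y" using h by (auto simp: paths_def)
  show "\<exists>M. \<forall>t\<le>M. h t = x \<and> t + y \<le> x"
    by (rule exI[of _ "min T (x - y)"]) (use T in auto)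
  show "\<exists>N. \<forall>t>N. h t = t + y \<and> x \<le> t + y"
    by (rule exI[of _ "max T' (x - y)"]) (use T' in auto)
qed

text \<open>Both sides count the boxes between the path and the corner, by diagonals \<open>F t\<close> or by rows \<open>G j\<close>.\<close>

lemma area_path_of:
  assumes \<mu>: "\<mu> \<in> fin_partitions"
  shows "area x y (path_of x y \<mu>) = int (partition_size \<mu>)"
proof -
  let ?h = "path_of x y \<mu>"
  have h: "?h \<in> paths x y" using \<mu> by (rule path_of_mem)
  obtain M where M: "\<And>t. t \<le> M \<Longrightarrow> ?h t = x \<and> t + y \<le> x" using paths_agree_outside(1)[OF h] by auto
  obtain N where N: "\<And>t. t > N \<Longrightarrow> ?h t = t + y \<and> x \<le> t + y" using paths_agree_outside(2)[OF h] by auto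
  have fin: "finite {j. \<mu> j \<noteq> 0}" using \<mu> by (simp add: fin_partitions_def)
  define F where "F = (\<lambda>t. {j::nat. t + y - x \<le> int j \<and> int j < ?h t - x})"
  define G where "G = (\<lambda>j::nat. {int j + x - y - int (\<mu> j)<..int j + x - y})"
  have F: "finite (F t) \<and> int (card (F t)) = ?h t - max x (t + y)" for t
  proof -
    have "F t = {nat (max x (t + y) - x)..<nat (?h t - x)}"
      by (auto simp: F_def)
    then show ?thesis using paths_ge[OF h, of t] by simp
  qed
  have FG: "j \<in> F t \<longleftrightarrow> t \<in> G j" for j t
    using path_of_iff[OF \<mu>, of j x y t] by (auto simp: F_def G_def)
  have sub: "t \<in> {M<..N}" "\<mu> j \<noteq> 0" if "j \<in> F t" for j t
  proof -
    have "t + y < ?h t" "x < ?h t" using that by (auto simp: F_def)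
    then show "t \<in> {M<..N}" using M[of t] N[of t] by (cases "t \<le> M"; cases "N < t") auto
    show "\<mu> j \<noteq> 0" using that unfolding FG by (auto simp: G_def)
  qed
  have "area x y ?h = (\<Sum>t\<in>{M<..N}. ?h t - max x (t + y))"
    by (rule area_eq_window) (simp_all add: M N)
  also have "\<dots> = int (card (Sigma {M<..N} F))"
    using F by (simp add: card_SigmaI)
  also have "card (Sigma {M<..N} F) = card (Sigma {j. \<mu> j \<noteq> 0} G)"
  proof (rule bij_betw_same_card[of prod.swap])
    show "bij_betw prod.swap (Sigma {M<..N} F) (Sigma {j. \<mu> j \<noteq> 0} G)"
    proof (rule bij_betw_byWitness[where f' = prod.swap])
      show "prod.swap ` Sigma {M<..N} F \<subseteq> Sigma {j. \<mu> j \<noteq> 0} G"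
        using FG sub(2) by auto
      show "prod.swap ` Sigma {j. \<mu> j \<noteq> 0} G \<subseteq> Sigma {M<..N} F"
        using FG sub(1) by auto
    qed auto
  qed
  also have "\<dots> = partition_size \<mu>"
    unfolding partition_size_def using fin by (subst card_SigmaI) (auto simp: G_def)
  finally show ?thesis .
qed

section \<open>Operations on paths\<close>

lemma paths_translate:
  assumes "h \<in> paths x y"
  shows "(\<lambda>t. h (t - c) - d) \<in> paths (x - d) (y - c - d)"
proof (rule pathsI)
  obtain T where T: "\<And>s. s \<le> T \<Longrightarrow> h s = x" using assms by (auto simp: paths_def)
  obtain T' where T': "\<And>s. s \<ge> T' \<Longrightarrow> h s = s + y" using assms by (auto simp: paths_def)
  show "h (t + 1 - c) - d \<in> {h (t - c) - d, h (t - c) - d + 1}" for t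
  proof -
    have "h (t - c + 1) \<in> {h (t - c), h (t - c) + 1}" using assms by (simp add: paths_def)
    moreover have "t - c + 1 = t + 1 - c" by simp
    ultimately show ?thesis by auto
  qed
  show "\<exists>T. \<forall>t\<le>T. h (t - c) - d = x - d"
    by (rule exI[of _ "T + c"]) (use T in auto)
  show "\<exists>T. \<forall>t\<ge>T. h (t - c) - d = t + (y - c - d)"
    by (rule exI[of _ "T' + c"]) (use T' in auto)
qed

lemma paths_splice:
  assumes f: "f \<in> paths x y" and g: "g \<in> paths x' y'" and eq: "f s = g s"
  shows "(\<lambda>t. if t > s then f t else g t) \<in> paths x' y"
proof (rule pathsI)
  obtain T where T: "\<And>s. s \<le> T \<Longrightarrow> g s = x'" using g by (auto simp: paths_def)
  obtain T' where T': "\<And>s. s \<ge> T' \<Longrightarrow> f s = s + y" using f by (auto simp: paths_def)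
  show "(if t + 1 > s then f (t + 1) else g (t + 1)) \<in>
      {if t > s then f t else g t, (if t > s then f t else g t) + 1}" for t
  proof -
    have "f (t + 1) \<in> {f t, f t + 1}" "g (t + 1) \<in> {g t, g t + 1}"
      using f g by (simp_all add: paths_def)
    then show ?thesis using eq by (cases "t > s"; cases "t = s") simp_all
  qed
  show "\<exists>T. \<forall>t\<le>T. (if t > s then f t else g t) = x'"
    by (rule exI[of _ "min T s"]) (use T in auto)
  show "\<exists>T. \<forall>t\<ge>T. (if t > s then f t else g t) = t + y"
    by (rule exI[of _ "max T' (s + 1)"]) (use T' in auto)
qed

text \<open>The difference of two paths changes by at most one in a step, so it cannot change its sign without
  a zero. The comparison starts at the right end, because the ends \<open>y\<close> are fixed throughout
  and only the left ends get permuted.\<close>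

lemma paths_less_if_no_meeting:
  assumes f: "f \<in> paths x y" and g: "g \<in> paths x' y'" and "y' < y" and ne: "\<And>t. f t \<noteq> g t"
  shows "g t < f t"
proof (rule ccontr)
  assume "\<not> g t < f t"
  have less: "f (t + int d) < g (t + int d)" for d
  proof (induction d)
    case 0
    show ?case using \<open>\<not> g t < f t\<close> ne[of t] by simp
  next
    case (Suc d)
    have "f (t + int d + 1) \<in> {f (t + int d), f (t + int d) + 1}"
      "g (t + int d + 1) \<in> {g (t + int d), g (t + int d) + 1}"
      using f g by (simp_all add: paths_def)
    then have "f (t + int d + 1) \<le> g (t + int d + 1)" using Suc.IH by auto
    moreover have "t + int (Suc d) = t + int d + 1" by simp
    ultimately show ?case using ne[of "t + int d + 1"] by (simp only: less_le) simp
  qed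
  obtain T where T: "\<And>s. s \<ge> T \<Longrightarrow> f s = s + y" using f by (auto simp: paths_def)
  obtain T' where T': "\<And>s. s \<ge> T' \<Longrightarrow> g s = s + y'" using g by (auto simp: paths_def)
  define u where "u = max t (max T T')"
  have "t + int (nat (u - t)) = u" by (simp add: u_def)
  then have "f u < g u" using less[of "nat (u - t)"] by simp
  then show False using T[of u] T'[of u] \<open>y' < y\<close> by (simp add: u_def)
qed

lemma paths_less_imp_start_less:
  assumes f: "f \<in> paths x y" and g: "g \<in> paths x' y'" and less: "\<And>t. g t < f t"
  shows "x' < x"
proof -
  obtain T where T: "\<And>s. s \<le> T \<Longrightarrow> f s = x" using f by (auto simp: paths_def)
  obtain T' where T': "\<And>s. s \<le> T' \<Longrightarrow> g s = x'" using g by (auto simp: paths_def)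
  show ?thesis using less[of "min T T'"] T[of "min T T'"] T'[of "min T T'"] by simp
qed

lemma sum_max_window:
  fixes x y M N :: int
  assumes "M + y \<le> x" "x \<le> N + y"
  shows "2 * (\<Sum>t\<in>{M<..N}. max x (t + y)) = 2 * x * (N - M) + (N + y - x) * (N + y - x + 1)"
proof -
  have "2 * (\<Sum>t\<in>{M<..x - y + int d}. max x (t + y)) = 2 * x * (x - y + int d - M) + int d * (int d + 1)" for d
  proof (induction d)
    case 0
    have "(\<Sum>t\<in>{M<..x - y}. max x (t + y)) = (\<Sum>t\<in>{M<..x - y}. x)" by (intro sum.cong) auto
    then show ?case using assms(1) by simp
  next
    case (Suc d)
    have "{M<..x - y + int (Suc d)} = insert (x - y + int (Suc d)) {M<..x - y + int d}"
      using assms(1) by auto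
    then have "(\<Sum>t\<in>{M<..x - y + int (Suc d)}. max x (t + y)) =
        x + int d + 1 + (\<Sum>t\<in>{M<..x - y + int d}. max x (t + y))" by simp
    then show ?case using Suc.IH by (simp add: algebra_simps)
  qed
  from this[of "nat (N - (x - y))"] show ?thesis using assms(2) by (simp add: algebra_simps)
qed

text \<open>Areas are taken relative to corners that depend on the ends of the path. Sums over a large common
  window make paths with different ends comparable, at the price of the area under the corner, which
  is quadratic in \<open>x\<close> and \<open>y\<close>.\<close>

lemma sum_window_eq_area:
  assumes "h \<in> paths x y"
  shows "\<exists>M0 N0. \<forall>M\<le>M0. \<forall>N\<ge>N0.
    2 * (\<Sum>t\<in>{M<..N}. h t) = 2 * area x y h + 2 * x * (N - M) + (N + y - x) * (N + y - x + 1)"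
proof -
  obtain M0 where M0: "\<And>t. t \<le> M0 \<Longrightarrow> h t = x \<and> t + y \<le> x" using paths_agree_outside(1)[OF assms] by auto
  obtain N0 where N0: "\<And>t. t > N0 \<Longrightarrow> h t = t + y \<and> x \<le> t + y" using paths_agree_outside(2)[OF assms] by auto
  have "2 * (\<Sum>t\<in>{M<..N}. h t) = 2 * area x y h + 2 * x * (N - M) + (N + y - x) * (N + y - x + 1)"
    if M: "M \<le> M0" and N: "N \<ge> max N0 (x - y)" for M N
  proof -
    have "area x y h = (\<Sum>t\<in>{M<..N}. h t - max x (t + y))"
      by (rule area_eq_window) (use M0 N0 M N in auto)
    then have "2 * (\<Sum>t\<in>{M<..N}. h t) = 2 * area x y h + 2 * (\<Sum>t\<in>{M<..N}. max x (t + y))"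
      by (simp add: sum_subtractf)
    also have "2 * (\<Sum>t\<in>{M<..N}. max x (t + y)) = 2 * x * (N - M) + (N + y - x) * (N + y - x + 1)"
      by (rule sum_max_window) (use M0[of M] M N in auto)
    finally show ?thesis by simp
  qed
  then show ?thesis by (intro exI allI impI)
qed

lemma sum_window_extend:
  fixes D :: "int \<Rightarrow> int"
  assumes "M \<le> M0" "M0 \<le> s" "\<And>t. t \<le> M0 \<Longrightarrow> D t = \<delta>"
  shows "(\<Sum>t\<in>{M<..s}. D t) = (M0 - M) * \<delta> + (\<Sum>t\<in>{M0<..s}. D t)"
proof -
  have "{M<..s} = {M<..M0} \<union> {M0<..s}" using assms(1,2) by auto
  then have "(\<Sum>t\<in>{M<..s}. D t) = (\<Sum>t\<in>{M<..M0}. D t) + (\<Sum>t\<in>{M0<..s}. D t)"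
    by (simp add: sum.union_disjoint)
  also have "(\<Sum>t\<in>{M<..M0}. D t) = (\<Sum>t\<in>{M<..M0}. \<delta>)" by (intro sum.cong) (use assms(3) in auto)
  finally show ?thesis using assms(1) by simp
qed

text \<open>The initial parts of \<open>f\<close> and of the translate of \<open>g\<close> by \<open>(c, d)\<close> are exchanged. The two cuts
  are at times that differ by \<open>c\<close>, so what does not cancel is a stretch of \<open>c\<close> steps far in the
  past, where both paths are constant.\<close>

lemma sum_window_exchange:
  assumes f: "f \<in> paths x y" and g: "g \<in> paths x' y'"
  shows "\<exists>M0 N0. \<forall>M\<le>M0. \<forall>N\<ge>N0.
    (\<Sum>t\<in>{M<..N}. if t > s then f t else g (t - c) - d) +
    (\<Sum>t\<in>{M<..N}. if t > s - c then g t else f (t + c) + d) =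
    (\<Sum>t\<in>{M<..N}. f t) + (\<Sum>t\<in>{M<..N}. g t) + c * (x' - d - x)"
proof -
  obtain T where T: "\<And>s. s \<le> T \<Longrightarrow> f s = x" using f by (auto simp: paths_def)
  obtain T' where T': "\<And>s. s \<le> T' \<Longrightarrow> g s = x'" using g by (auto simp: paths_def)
  define D where "D = (\<lambda>t. g (t - c) - d - f t)"
  \<comment> \<open>Before \<open>M0\<close> both paths are constant, and so is the difference \<open>D\<close> that is cut in or out.\<close>
  define M0 where "M0 = min s (min T (T' + c))"
  have D: "D t = x' - d - x" if "t \<le> M0" for t
    using that T[of t] T'[of "t - c"] by (simp add: D_def M0_def)
  have "(\<Sum>t\<in>{M<..N}. if t > s then f t else g (t - c) - d) +
      (\<Sum>t\<in>{M<..N}. if t > s - c then g t else f (t + c) + d) =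
      (\<Sum>t\<in>{M<..N}. f t) + (\<Sum>t\<in>{M<..N}. g t) + c * (x' - d - x)"
    if M: "M \<le> min M0 (M0 - c)" and N: "N \<ge> max s (s - c)" for M N
  proof -
    have cut: "(\<Sum>t\<in>{M<..N}. if t > r then F t else G t) = (\<Sum>t\<in>{M<..N}. F t) + (\<Sum>t\<in>{M<..r}. G t - F t)"
      if "r \<le> N" for r and F G :: "int \<Rightarrow> int"
    proof -
      have "(\<Sum>t\<in>{M<..N}. if t > r then F t else G t) =
          (\<Sum>t\<in>{M<..N}. F t + (if t \<in> {M<..r} then G t - F t else 0))"
        by (intro sum.cong) auto
      also have "\<dots> = (\<Sum>t\<in>{M<..N}. F t) + (\<Sum>t\<in>{M<..N} \<inter> {M<..r}. G t - F t)"
        by (simp only: sum.distrib sum.inter_restrict[OF finite_greaterThanAtMost_int])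
      also have "{M<..N} \<inter> {M<..r} = {M<..r}" using that by auto
      finally show ?thesis .
    qed
    have "(\<Sum>t\<in>{M<..N}. if t > s then f t else g (t - c) - d) = (\<Sum>t\<in>{M<..N}. f t) + (\<Sum>t\<in>{M<..s}. D t)"
      using cut[of s f "\<lambda>t. g (t - c) - d"] N by (simp add: D_def)
    moreover have "(\<Sum>t\<in>{M<..N}. if t > s - c then g t else f (t + c) + d) =
        (\<Sum>t\<in>{M<..N}. g t) + (\<Sum>t\<in>{M<..s - c}. - D (t + c))"
      using cut[of "s - c" g "\<lambda>t. f (t + c) + d"] N by (simp add: D_def algebra_simps)
    moreover have "(\<Sum>t\<in>{M<..s - c}. - D (t + c)) = (\<Sum>t\<in>{M + c<..s}. - D t)"
      by (rule sum.reindex_bij_witness[of _ "\<lambda>t. t - c" "\<lambda>t. t + c"]) auto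
    moreover have "(\<Sum>t\<in>{M<..s}. D t) = (M0 - M) * (x' - d - x) + (\<Sum>t\<in>{M0<..s}. D t)"
      by (rule sum_window_extend) (use M D in \<open>auto simp: M0_def\<close>)
    moreover have "(\<Sum>t\<in>{M + c<..s}. D t) = (M0 - (M + c)) * (x' - d - x) + (\<Sum>t\<in>{M0<..s}. D t)"
      by (rule sum_window_extend) (use M D in \<open>auto simp: M0_def\<close>)
    ultimately show ?thesis by (simp add: sum_negf algebra_simps)
  qed
  then show ?thesis by (intro exI allI impI)
qed

section \<open>Families of paths on a cylinder\<close>

text \<open>The translates of the strands have left levels \<open>X l - m * p\<close> and right ends \<open>Y l - m * p'\<close>. The
  assumptions say that both sequences decrease strictly when the labels \<open>(l, m)\<close> are read turn by
  turn.\<close>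

locale cylinder =
  fixes n :: nat and p p' :: int and X Y :: "nat \<Rightarrow> int"
  assumes n_pos: "n \<ge> 1" and p_pos: "p > 0" and p'_pos: "p' > 0"
    and X_less: "\<And>i j. \<lbrakk>1 \<le> i; i < j; j \<le> n\<rbrakk> \<Longrightarrow> X j < X i" and X_wrap: "X 1 - p < X n"
    and Y_less: "\<And>i j. \<lbrakk>1 \<le> i; i < j; j \<le> n\<rbrakk> \<Longrightarrow> Y j < Y i" and Y_wrap: "Y 1 - p' < Y n"
begin

text \<open>The left ends form the orbit of \<open>X\<close> under the affine Weyl group: \<open>\<sigma>\<close> permutes the coordinates
  and \<open>\<alpha>\<close> translates by \<open>p\<close> times a root lattice vector.\<close>

definition start :: "(nat \<Rightarrow> nat) \<Rightarrow> (nat \<Rightarrow> int) \<Rightarrow> nat \<Rightarrow> int" where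
  "start \<sigma> \<alpha> j = X (inv \<sigma> j) + p * \<alpha> j"

definition zero_sum :: "(nat \<Rightarrow> int) set" where
  "zero_sum = {\<alpha>. (\<forall>k. k \<notin> {1..n} \<longrightarrow> \<alpha> k = 0) \<and> (\<Sum>k=1..n. \<alpha> k) = 0}"

text \<open>The exponent of the theta series in terms of the integer vectors \<open>X\<close> and \<open>Y\<close>. The norm of \<open>\<alpha>\<close> is
  even because the coordinates of \<open>\<alpha>\<close> have sum zero.\<close>

definition energy :: "(nat \<Rightarrow> nat) \<Rightarrow> (nat \<Rightarrow> int) \<Rightarrow> int" where
  "energy \<sigma> \<alpha> = p * p' * ((\<Sum>k=1..n. \<alpha> k * \<alpha> k) div 2) +
     (\<Sum>k=1..n. (p' * X (inv \<sigma> k) - p * Y k) * \<alpha> k) + (\<Sum>k=1..n. (X k - X (inv \<sigma> k)) * Y k)"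

definition families :: "(nat \<Rightarrow> nat) \<Rightarrow> (nat \<Rightarrow> int) \<Rightarrow> (nat \<Rightarrow> int \<Rightarrow> int) set" where
  "families \<sigma> \<alpha> = (\<Pi>\<^sub>E j\<in>{1..n}. paths (start \<sigma> \<alpha> j) (Y j))"

definition total_area :: "(nat \<Rightarrow> nat) \<Rightarrow> (nat \<Rightarrow> int) \<Rightarrow> (nat \<Rightarrow> int \<Rightarrow> int) \<Rightarrow> int" where
  "total_area \<sigma> \<alpha> h = (\<Sum>j=1..n. area (start \<sigma> \<alpha> j) (Y j) (h j))"

text \<open>The strand with label \<open>(l, m)\<close> is the \<open>l\<close>-th path after \<open>m\<close> turns around the cylinder. One turn
  lowers the left level by \<open>p\<close> and the right end by \<open>p'\<close>, so it has to shift the time by \<open>p' - p\<close>.\<close>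

definition strand :: "(nat \<Rightarrow> int \<Rightarrow> int) \<Rightarrow> nat \<times> int \<Rightarrow> int \<Rightarrow> int" where
  "strand h A t = h (fst A) (t - snd A * (p' - p)) - snd A * p"

definition labels_at :: "(nat \<Rightarrow> int \<Rightarrow> int) \<Rightarrow> int \<times> int \<Rightarrow> (nat \<times> int) set" where
  "labels_at h v = {A. fst A \<in> {1..n} \<and> strand h A (fst v) = snd v}"

definition meets :: "(nat \<Rightarrow> int \<Rightarrow> int) \<Rightarrow> (int \<times> int) set" where
  "meets h = {v. \<exists>A\<in>labels_at h v. \<exists>B\<in>labels_at h v. A \<noteq> B}"

section \<open>Exchanging the initial parts of two strands\<close>

text \<open>The \<open>i\<close>-th path up to time \<open>s\<close> is exchanged with the strand \<open>(l, m)\<close>. For the \<open>l\<close>-th path itself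
  this is an exchange with the strand \<open>(i, - m)\<close>, up to the translated time.\<close>

definition exchange :: "int \<Rightarrow> nat \<Rightarrow> nat \<Rightarrow> int \<Rightarrow> (nat \<Rightarrow> int \<Rightarrow> int) \<Rightarrow> nat \<Rightarrow> int \<Rightarrow> int" where
  "exchange s i l m h = h(
     i := \<lambda>t. if t > s then h i t else h l (t - m * (p' - p)) - m * p,
     l := \<lambda>t. if t > s - m * (p' - p) then h l t else h i (t + m * (p' - p)) + m * p)"

text \<open>At a fixed time \<open>t\<close> the exchange merely permutes the labels of the strands: the map below is the
  involution by which it does so.\<close>

definition relabel :: "int \<Rightarrow> nat \<Rightarrow> nat \<Rightarrow> int \<Rightarrow> int \<Rightarrow> nat \<times> int \<Rightarrow> nat \<times> int" where
  "relabel s i l m t A =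
     (if fst A = i then if t - snd A * (p' - p) > s then A else (l, snd A + m)
      else if fst A = l then if t - snd A * (p' - p) > s - m * (p' - p) then A else (i, snd A - m)
      else A)"

lemma strand_exchange:
  assumes "i \<noteq> l"
  shows "strand (exchange s i l m h) A t = strand h (relabel s i l m t A) t"
proof (cases A)
  case (Pair k q)
  consider "k = i" | "k = l" | "k \<noteq> i" "k \<noteq> l" by blast
  then show ?thesis
  proof cases
    case 1
    then show ?thesis using assms Pair by (simp add: strand_def exchange_def relabel_def algebra_simps)
  next
    case 2
    then show ?thesis using assms Pair by (simp add: strand_def exchange_def relabel_def algebra_simps)
  next
    case 3
    then show ?thesis using Pair by (simp add: strand_def exchange_def relabel_def)
  qed
qed

lemma relabel_relabel:
  assumes "i \<noteq> l"
  shows "relabel s i l m t (relabel s i l m t A) = A"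
  using assms by (cases A) (simp add: relabel_def algebra_simps)

lemma fst_relabel: "i \<in> S \<Longrightarrow> l \<in> S \<Longrightarrow> fst (relabel s i l m t A) \<in> S \<longleftrightarrow> fst A \<in> S"
  by (auto simp: relabel_def)

lemma exchange_exchange:
  assumes "i \<noteq> l"
  shows "exchange s i l m (exchange s i l m h) = h"
  using assms by (intro ext) (simp add: exchange_def)

lemma labels_at_exchange:
  assumes "i \<noteq> l" "i \<in> {1..n}" "l \<in> {1..n}"
  shows "A \<in> labels_at (exchange s i l m h) v \<longleftrightarrow> relabel s i l m (fst v) A \<in> labels_at h v"
  using fst_relabel[of i "{1..n}" l s m "fst v" A] assms 
  by (simp only: labels_at_def mem_Collect_eq strand_exchange[OF assms(1)])

text \<open>A permutation of the labels cannot create a point with two of them.\<close>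

lemma meets_exchange_subset:
  assumes "i \<noteq> l" "i \<in> {1..n}" "l \<in> {1..n}"
  shows "meets (exchange s i l m h) \<subseteq> meets h"
proof
  fix v assume "v \<in> meets (exchange s i l m h)"
  then obtain A B where AB: "A \<in> labels_at (exchange s i l m h) v" "B \<in> labels_at (exchange s i l m h) v" "A \<noteq> B"
    by (auto simp: meets_def)
  let ?r = "relabel s i l m (fst v)"
  have "?r A \<noteq> ?r B" using AB(3) relabel_relabel[OF assms(1), of s m "fst v" A]
      relabel_relabel[OF assms(1), of s m "fst v" B] by auto
  moreover have "?r A \<in> labels_at h v" "?r B \<in> labels_at h v" using AB labels_at_exchange[OF assms] by simp_all
  ultimately show "v \<in> meets h" by (auto simp: meets_def)
qed

lemma meets_exchange:
  assumes "i \<noteq> l" "i \<in> {1..n}" "l \<in> {1..n}"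
  shows "meets (exchange s i l m h) = meets h"
  using meets_exchange_subset[OF assms, of s m h] meets_exchange_subset[OF assms, of s m "exchange s i l m h"]
    exchange_exchange[OF assms(1), of s m h] by simp

text \<open>A translate of a path never meets the path. If the heights agreed, then a time shift by
  \<open>d * (p' - p)\<close> would change the height by \<open>- d * p\<close>. With steps \<open>0\<close> and \<open>1\<close> this is impossible
  since \<open>p\<close> and \<open>p'\<close> are both positive.\<close>

lemma strand_inj:
  assumes h: "h i \<in> paths x y" and eq: "strand h (i, q) t = strand h (i, q') t"
  shows "q = q'"
proof -
  have False if "q < q'" and eq: "strand h (i, q) t = strand h (i, q') t" for q q'
  proof -
    define d where "d = q' - q"
    define u where "u = t - q * (p' - p)"
    have d: "d > 0" using that(1) by (simp add: d_def)
    have "t - q' * (p' - p) = u - d * (p' - p)" by (simp add: u_def d_def algebra_simps)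
    then have e: "h i u = h i (u - d * (p' - p)) - d * p"
      using eq by (simp add: strand_def u_def[symmetric]) (simp add: d_def algebra_simps)
    have pos: "d * p > 0" "d * p' > 0" using d p_pos p'_pos by simp_all
    show False
    proof (cases "p' - p \<ge> 0")
      case True
      then have "d * (p' - p) \<ge> 0" using d by simp
      then have "h i (u - d * (p' - p)) \<le> h i u" by (intro paths_bounds(1)[OF h]) simp
      then show False using e pos by simp
    next
      case False
      then have "d * (p' - p) \<le> 0" using d by (simp add: mult_le_0_iff)
      then have "h i (u - d * (p' - p)) \<le> h i u + (u - d * (p' - p) - u)"
        by (intro paths_bounds(2)[OF h]) simp
      then show False using e pos by (simp add: algebra_simps)
    qed
  qed
  from this[of q q'] this[of q' q] show ?thesis using eq by (cases q q' rule: linorder_cases) auto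
qed

text \<open>At the point of the exchange the two labels involved are swapped with each other. No other translate
  of the same two paths passes this point, by \<open>strand_inj\<close>, so all other labels stay as they are.\<close>

lemma labels_at_exchange_eq:
  assumes il: "i \<noteq> l" "i \<in> {1..n}" "l \<in> {1..n}"
    and h: "h i \<in> paths x y" "h l \<in> paths x' y'"
    and at: "(i, q) \<in> labels_at h v" "(l, q') \<in> labels_at h v"
  shows "labels_at (exchange (fst v - q * (p' - p)) i l (q' - q) h) v = labels_at h v"
proof -
  let ?s = "fst v - q * (p' - p)"
  let ?r = "relabel ?s i l (q' - q) (fst v)"
  have r_eq: "?r (i, q) = (l, q')" "?r (l, q') = (i, q)"
    using il(1) by (simp_all add: relabel_def algebra_simps)
  have uniq: "A = (i, q)" if "A \<in> labels_at h v" "fst A = i" for A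
    using that at(1) strand_inj[of h i, OF h(1), of "snd A" "fst v" q] by (cases A) (simp add: labels_at_def)
  have uniq': "A = (l, q')" if "A \<in> labels_at h v" "fst A = l" for A
    using that at(2) strand_inj[of h l, OF h(2), of "snd A" "fst v" q'] by (cases A) (simp add: labels_at_def)
  have fst_r: "fst A \<in> {i, l} \<Longrightarrow> fst (?r A) \<in> {i, l}" "fst A \<notin> {i, l} \<Longrightarrow> ?r A = A" for A
    by (auto simp: relabel_def)
  have sub: "?r A \<in> labels_at h v" if "A \<in> labels_at h v" for A
  proof (cases "fst A \<in> {i, l}")
    case True
    then have "A = (i, q) \<or> A = (l, q')" using uniq[OF that] uniq'[OF that] by auto
    then show ?thesis using r_eq at by auto
  qed (use that fst_r(2) in simp)
  have from_r: "A \<in> labels_at h v" if "?r A \<in> labels_at h v" for A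
    using sub[OF that] relabel_relabel[OF il(1)] by simp
  show ?thesis
  proof (rule set_eqI)
    fix A
    show "A \<in> labels_at (exchange ?s i l (q' - q) h) v \<longleftrightarrow> A \<in> labels_at h v"
      unfolding labels_at_exchange[OF il, of A ?s "q' - q" h v] using sub[of A] from_r[of A] by argo
  qed
qed

section \<open>Conservation of area plus energy\<close>

lemma sum_split_two:
  fixes F :: "nat \<Rightarrow> int"
  assumes "i \<noteq> l" "i \<in> {1..n}" "l \<in> {1..n}"
  shows "(\<Sum>j=1..n. F j) = F i + F l + (\<Sum>j\<in>{1..n} - {i, l}. F j)"
proof -
  have "{i, l} \<subseteq> {1..n}" using assms by simp
  then have "(\<Sum>j\<in>{1..n}. F j) = (\<Sum>j\<in>{1..n} - {i, l}. F j) + (\<Sum>j\<in>{i, l}. F j)"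
    by (rule sum.subset_diff) simp
  then show ?thesis using assms(1) by simp
qed

lemma inv_sum:
  fixes F :: "nat \<Rightarrow> int"
  assumes "\<sigma> permutes {1..n}"
  shows "(\<Sum>j=1..n. F (inv \<sigma> j)) = (\<Sum>j=1..n. F j)"
  using sum.permute[OF permutes_inv[OF assms], of F] by (simp add: o_def)

lemma even_sum_squares:
  assumes "\<alpha> \<in> zero_sum"
  shows "2 * ((\<Sum>k=1..n. \<alpha> k * \<alpha> k) div 2) = (\<Sum>k=1..n. \<alpha> k * \<alpha> k)"
proof -
  have "even (\<Sum>k=1..n. \<alpha> k * \<alpha> k - \<alpha> k)" by (intro dvd_sum) simp
  then have "even (\<Sum>k=1..n. \<alpha> k * \<alpha> k)" using assms by (simp add: sum_subtractf zero_sum_def)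
  then show ?thesis by simp
qed

text \<open>In terms of the starting points the energy is a quadratic polynomial without reference to the
  permutation. This is the completed square behind the exponent of the theta series.\<close>

lemma energy_eq_start:
  assumes \<sigma>: "\<sigma> permutes {1..n}" and \<alpha>: "\<alpha> \<in> zero_sum"
  shows "2 * p * energy \<sigma> \<alpha> = (\<Sum>j=1..n. p' * (start \<sigma> \<alpha> j)\<^sup>2 - 2 * p * start \<sigma> \<alpha> j * Y j)
    - (\<Sum>j=1..n. p' * (X j)\<^sup>2 - 2 * p * X j * Y j)"
proof -
  have "2 * p * energy \<sigma> \<alpha> = p * p * p' * (2 * ((\<Sum>k=1..n. \<alpha> k * \<alpha> k) div 2)) +
     2 * p * (\<Sum>k=1..n. (p' * X (inv \<sigma> k) - p * Y k) * \<alpha> k) + 2 * p * (\<Sum>k=1..n. (X k - X (inv \<sigma> k)) * Y k)"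
    by (simp add: energy_def algebra_simps)
  also have "\<dots> = (\<Sum>k=1..n. p * p * p' * (\<alpha> k * \<alpha> k) + 2 * p * ((p' * X (inv \<sigma> k) - p * Y k) * \<alpha> k) +
      2 * p * ((X k - X (inv \<sigma> k)) * Y k))"
    unfolding even_sum_squares[OF \<alpha>] by (simp only: sum.distrib sum_distrib_left)
  also have "\<dots> = (\<Sum>k=1..n. (p' * (start \<sigma> \<alpha> k)\<^sup>2 - 2 * p * start \<sigma> \<alpha> k * Y k) +
      2 * p * X k * Y k - p' * (X (inv \<sigma> k))\<^sup>2)"
    by (intro sum.cong refl) (simp add: start_def power2_eq_square algebra_simps)
  also have "\<dots> = (\<Sum>j=1..n. p' * (start \<sigma> \<alpha> j)\<^sup>2 - 2 * p * start \<sigma> \<alpha> j * Y j) +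
      (\<Sum>j=1..n. 2 * p * X j * Y j) - (\<Sum>j=1..n. p' * (X (inv \<sigma> j))\<^sup>2)"
    by (simp only: sum.distrib sum_subtractf)
  also have "(\<Sum>j=1..n. p' * (X (inv \<sigma> j))\<^sup>2) = (\<Sum>j=1..n. p' * (X j)\<^sup>2)"
    by (rule inv_sum[OF \<sigma>])
  finally show ?thesis by (simp add: sum_subtractf)
qed

text \<open>Only the exchanged pair contributes to the change of area plus energy. By \<open>sum_window_eq_area\<close> the
  areas differ from window sums by quadratic terms in the left ends. In the combination with the
  energy these terms have the coefficient \<open>p' - p\<close> left, and they are balanced by the change of the
  window sums, which \<open>sum_window_exchange\<close> gives as \<open>m * (p' - p)\<close> times the change of \<open>x\<close>.\<close>

lemma pair_conservation:
  fixes x w y z m s c :: int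
  assumes f: "f \<in> paths x y" and g: "g \<in> paths w z" and c: "c = m * (p' - p)"
    and f': "(\<lambda>t. if t > s then f t else g (t - c) - m * p) \<in> paths (w - m * p) y" (is "?f \<in> _")
    and g': "(\<lambda>t. if t > s - c then g t else f (t + c) + m * p) \<in> paths (x + m * p) z" (is "?g \<in> _")
  shows "2 * p * (area (w - m * p) y ?f + area (x + m * p) z ?g) +
      (p' * (w - m * p)\<^sup>2 - 2 * p * (w - m * p) * y) + (p' * (x + m * p)\<^sup>2 - 2 * p * (x + m * p) * z) =
    2 * p * (area x y f + area w z g) + (p' * x\<^sup>2 - 2 * p * x * y) + (p' * w\<^sup>2 - 2 * p * w * z)"
proof -
  let ?win = "\<lambda>M N h. \<Sum>t\<in>{M<..N}. h t :: int"
  let ?E = "\<lambda>M N h x y. 2 * ?win M N h = 2 * area x y h + 2 * x * (N - M) + (N + y - x) * (N + y - x + 1)"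
  obtain M1 N1 where 1: "\<And>M N. M \<le> M1 \<Longrightarrow> N \<ge> N1 \<Longrightarrow> ?E M N f x y" using sum_window_eq_area[OF f] by blast
  obtain M2 N2 where 2: "\<And>M N. M \<le> M2 \<Longrightarrow> N \<ge> N2 \<Longrightarrow> ?E M N g w z" using sum_window_eq_area[OF g] by blast
  obtain M3 N3 where 3: "\<And>M N. M \<le> M3 \<Longrightarrow> N \<ge> N3 \<Longrightarrow> ?E M N ?f (w - m * p) y"
    using sum_window_eq_area[OF f'] by blast
  obtain M4 N4 where 4: "\<And>M N. M \<le> M4 \<Longrightarrow> N \<ge> N4 \<Longrightarrow> ?E M N ?g (x + m * p) z"
    using sum_window_eq_area[OF g'] by blast
  obtain M5 N5 where 5: "\<And>M N. M \<le> M5 \<Longrightarrow> N \<ge> N5 \<Longrightarrow>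
      ?win M N ?f + ?win M N ?g = ?win M N f + ?win M N g + c * (w - m * p - x)"
    using sum_window_exchange[OF f g, of s c "m * p"] by blast
  define M where "M = Min {M1, M2, M3, M4, M5}"
  define N where "N = Max {N1, N2, N3, N4, N5}"
  have M: "M \<le> M1" "M \<le> M2" "M \<le> M3" "M \<le> M4" "M \<le> M5" by (simp_all add: M_def)
  have N: "N \<ge> N1" "N \<ge> N2" "N \<ge> N3" "N \<ge> N4" "N \<ge> N5" by (simp_all add: N_def)
  define A where "A = 2 * area x y f"
  define B where "B = 2 * area w z g"
  define A' where "A' = 2 * area (w - m * p) y ?f"
  define B' where "B' = 2 * area (x + m * p) z ?g"
  have a: "A = 2 * ?win M N f - (2 * x * (N - M) + (N + y - x) * (N + y - x + 1))"
    using 1[OF M(1) N(1)] by (simp add: A_def)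
  have b: "B = 2 * ?win M N g - (2 * w * (N - M) + (N + z - w) * (N + z - w + 1))"
    using 2[OF M(2) N(2)] by (simp add: B_def)
  have a': "A' = 2 * ?win M N ?f - (2 * (w - m * p) * (N - M) + (N + y - (w - m * p)) * (N + y - (w - m * p) + 1))"
    using 3[OF M(3) N(3)] by (simp add: A'_def)
  have b': "B' = 2 * ?win M N ?g - (2 * (x + m * p) * (N - M) + (N + z - (x + m * p)) * (N + z - (x + m * p) + 1))"
    using 4[OF M(4) N(4)] by (simp add: B'_def)
  have "2 * ?win M N ?f + 2 * ?win M N ?g = 2 * ?win M N f + 2 * ?win M N g + 2 * c * (w - m * p - x)"
    using 5[OF M(5) N(5)] by simp
  then have e: "A' + B' = A + B + 2 * c * (w - m * p - x)
      + (2 * x * (N - M) + (N + y - x) * (N + y - x + 1)) + (2 * w * (N - M) + (N + z - w) * (N + z - w + 1))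
      - (2 * (w - m * p) * (N - M) + (N + y - (w - m * p)) * (N + y - (w - m * p) + 1))
      - (2 * (x + m * p) * (N - M) + (N + z - (x + m * p)) * (N + z - (x + m * p) + 1))"
    using a b a' b' by linarith
  have "p * (A' + B') + (p' * (w - m * p)\<^sup>2 - 2 * p * (w - m * p) * y) + (p' * (x + m * p)\<^sup>2 - 2 * p * (x + m * p) * z) =
      p * (A + B) + (p' * x\<^sup>2 - 2 * p * x * y) + (p' * w\<^sup>2 - 2 * p * w * z)"
    unfolding e c by (simp add: power2_eq_square algebra_simps)
  then show ?thesis by (simp add: A_def B_def A'_def B'_def algebra_simps)
qed

section \<open>The sign-reversing involution\<close>

definition meeting :: "(nat \<Rightarrow> int \<Rightarrow> int) \<Rightarrow> int \<times> int" where
  "meeting h = (SOME v. v \<in> meets h)"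

definition meeting_pair :: "(nat \<Rightarrow> int \<Rightarrow> int) \<Rightarrow> (nat \<times> int) \<times> (nat \<times> int)" where
  "meeting_pair h = (SOME (A, B). A \<in> labels_at h (meeting h) \<and> B \<in> labels_at h (meeting h) \<and> A \<noteq> B)"

type_synonym config = "(nat \<Rightarrow> nat) \<times> (nat \<Rightarrow> int) \<times> (nat \<Rightarrow> int \<Rightarrow> int)"

text \<open>The left ends of the new paths are \<open>start \<sigma> \<alpha> l - m * p\<close> and \<open>start \<sigma> \<alpha> i + m * p\<close>, which
  determines the new permutation and the new lattice vector.\<close>

definition exchange_config :: "int \<Rightarrow> nat \<Rightarrow> nat \<Rightarrow> int \<Rightarrow> config \<Rightarrow> config" where
  "exchange_config s i l m = (\<lambda>(\<sigma>, \<alpha>, h).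
     (Transposition.transpose i l \<circ> \<sigma>, \<alpha>(i := \<alpha> l - m, l := \<alpha> i + m), exchange s i l m h))"

text \<open>The chosen strands \<open>(i, q)\<close> and \<open>(l, q')\<close> are translated back by \<open>q\<close> turns, so that the first
  becomes the path \<open>i\<close> itself.\<close>

definition flip :: "config \<Rightarrow> config" where
  "flip c = (let h = snd (snd c); ((i, q), (l, q')) = meeting_pair h
     in exchange_config (fst (meeting h) - q * (p' - p)) i l (q' - q) c)"

definition configs :: "config set" where
  "configs = {(\<sigma>, \<alpha>, h). \<sigma> permutes {1..n} \<and> \<alpha> \<in> zero_sum \<and> h \<in> families \<sigma> \<alpha>}"

definition total :: "config \<Rightarrow> int" where
  "total = (\<lambda>(\<sigma>, \<alpha>, h). energy \<sigma> \<alpha> + total_area \<sigma> \<alpha> h)"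

lemma exchange_config_involution:
  assumes "i \<noteq> l"
  shows "exchange_config s i l m (exchange_config s i l m c) = c"
proof -
  obtain \<sigma> \<alpha> h where c: "c = (\<sigma>, \<alpha>, h)" by (cases c)
  have "Transposition.transpose i l \<circ> (Transposition.transpose i l \<circ> \<sigma>) = \<sigma>"
    by (simp add: fun_eq_iff)
  moreover have "(\<alpha>(i := \<alpha> l - m, l := \<alpha> i + m)) (i := (\<alpha>(i := \<alpha> l - m, l := \<alpha> i + m)) l - m,
      l := (\<alpha>(i := \<alpha> l - m, l := \<alpha> i + m)) i + m) = \<alpha>"
    using assms by (auto simp: fun_eq_iff)
  ultimately show ?thesis unfolding c exchange_config_def
    by (simp only: prod.case exchange_exchange[OF assms])
qed

lemma meeting_pairE:
  assumes c: "(\<sigma>, \<alpha>, h) \<in> configs" and meets: "meets h \<noteq> {}"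
  obtains i q l q' where "meeting_pair h = ((i, q), (l, q'))" "(i, q) \<in> labels_at h (meeting h)"
    "(l, q') \<in> labels_at h (meeting h)" "i \<noteq> l" "i \<in> {1..n}" "l \<in> {1..n}"
proof -
  have "meeting h \<in> meets h" unfolding meeting_def using meets by (simp add: some_in_eq)
  then have ex: "\<exists>P. (\<lambda>(A, B). A \<in> labels_at h (meeting h) \<and> B \<in> labels_at h (meeting h) \<and> A \<noteq> B) P"
    by (auto simp: meets_def)
  have P: "(\<lambda>(A, B). A \<in> labels_at h (meeting h) \<and> B \<in> labels_at h (meeting h) \<and> A \<noteq> B) (meeting_pair h)"
    unfolding meeting_pair_def by (rule someI_ex[OF ex])
  obtain i q l q' where eq: "meeting_pair h = ((i, q), (l, q'))" by (cases "meeting_pair h") auto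
  have mem: "(i, q) \<in> labels_at h (meeting h)" "(l, q') \<in> labels_at h (meeting h)" "(i, q) \<noteq> (l, q')"
    using P unfolding eq by simp_all
  then have il: "i \<in> {1..n}" "l \<in> {1..n}" by (simp_all add: labels_at_def)
  have "h i \<in> paths (start \<sigma> \<alpha> i) (Y i)" using c il by (auto simp: configs_def families_def)
  then have "i = l \<Longrightarrow> q = q'"
    using mem strand_inj[of h i "start \<sigma> \<alpha> i" "Y i" q "fst (meeting h)" q'] by (simp add: labels_at_def)
  then have "i \<noteq> l" using mem(3) by auto
  with that eq mem il show thesis by blast
qed

lemma exchange_config_props:
  fixes s m :: int
  assumes c: "(\<sigma>, \<alpha>, h) \<in> configs" and il: "i \<noteq> l" "i \<in> {1..n}" "l \<in> {1..n}"
    and meet: "h i s = h l (s - m * (p' - p)) - m * p"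
  shows "exchange_config s i l m (\<sigma>, \<alpha>, h) \<in> configs"
    and "total (exchange_config s i l m (\<sigma>, \<alpha>, h)) = total (\<sigma>, \<alpha>, h)"
    and "sign (fst (exchange_config s i l m (\<sigma>, \<alpha>, h))) = - sign \<sigma>"
proof -
  let ?\<sigma> = "Transposition.transpose i l \<circ> \<sigma>" and ?\<alpha> = "\<alpha>(i := \<alpha> l - m, l := \<alpha> i + m)"
    and ?h = "exchange s i l m h" and ?c = "m * (p' - p)"
  have \<sigma>: "\<sigma> permutes {1..n}" and \<alpha>: "\<alpha> \<in> zero_sum" and h: "h \<in> families \<sigma> \<alpha>"
    using c by (auto simp: configs_def)
  have hj: "h j \<in> paths (start \<sigma> \<alpha> j) (Y j)" if "j \<in> {1..n}" for j
    using h that by (auto simp: families_def)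
  have \<sigma>': "?\<sigma> permutes {1..n}"
    by (rule permutes_compose[OF \<sigma> permutes_swap_id[OF il(2,3)]])
  have "sum \<alpha> {1..n} = 0" using \<alpha> by (simp add: zero_sum_def)
  moreover have "sum ?\<alpha> {1..n} = sum \<alpha> {1..n}"
    using sum_split_two[OF il, of ?\<alpha>] sum_split_two[OF il, of \<alpha>] il(1) by simp
  ultimately have \<alpha>': "?\<alpha> \<in> zero_sum" using \<alpha> il by (auto simp: zero_sum_def)
  have "inv ?\<sigma> = inv \<sigma> \<circ> Transposition.transpose i l"
    using o_inv_distrib[OF bij_transpose permutes_bij[OF \<sigma>], of i l] by simp
  then have st: "start ?\<sigma> ?\<alpha> i = start \<sigma> \<alpha> l - m * p" "start ?\<sigma> ?\<alpha> l = start \<sigma> \<alpha> i + m * p"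
    "\<And>j. j \<noteq> i \<Longrightarrow> j \<noteq> l \<Longrightarrow> start ?\<sigma> ?\<alpha> j = start \<sigma> \<alpha> j"
    using il(1) by (simp_all add: start_def algebra_simps)
  have hi': "?h i = (\<lambda>t. if t > s then h i t else h l (t - ?c) - m * p)"
    and hl': "?h l = (\<lambda>t. if t > s - ?c then h l t else h i (t + ?c) + m * p)"
    and hj': "\<And>j. j \<noteq> i \<Longrightarrow> j \<noteq> l \<Longrightarrow> ?h j = h j"
    using il(1) by (simp_all add: exchange_def)
  have pi: "(\<lambda>t. if t > s then h i t else h l (t - ?c) - m * p) \<in> paths (start \<sigma> \<alpha> l - m * p) (Y i)"
    by (rule paths_splice[OF hj[OF il(2)] paths_translate[OF hj[OF il(3)]]]) (rule meet)
  have "(\<lambda>t. if t > s - ?c then h l t else h i (t - - ?c) - - (m * p)) \<in> paths (start \<sigma> \<alpha> i - - (m * p)) (Y l)"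
    by (rule paths_splice[OF hj[OF il(3)] paths_translate[OF hj[OF il(2)]]]) (use meet in simp)
  then have pl: "(\<lambda>t. if t > s - ?c then h l t else h i (t + ?c) + m * p) \<in> paths (start \<sigma> \<alpha> i + m * p) (Y l)"
    by (simp only: diff_minus_eq_add cong: if_cong)
  have h': "?h \<in> families ?\<sigma> ?\<alpha>"
    unfolding families_def
  proof (rule PiE_I)
    fix j assume j: "j \<in> {1..n}"
    consider "j = i" | "j = l" | "j \<noteq> i" "j \<noteq> l" by blast
    then show "?h j \<in> paths (start ?\<sigma> ?\<alpha> j) (Y j)"
    proof cases
      case 1
      then show ?thesis using pi by (simp only: hi' st)
    next
      case 2
      then show ?thesis using pl by (simp only: hl' st)
    next
      case 3
      show ?thesis unfolding hj'[OF 3] st(3)[OF 3] by (rule hj[OF j])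
    qed
  next
    fix j assume "j \<notin> {1..n}"
    then show "?h j = undefined" using h il by (auto simp: exchange_def families_def PiE_def extensional_def)
  qed
  show "exchange_config s i l m (\<sigma>, \<alpha>, h) \<in> configs"
    using \<sigma>' \<alpha>' h' by (simp add: exchange_config_def configs_def)
  let ?G = "\<lambda>\<sigma> \<alpha> h j. 2 * p * area (start \<sigma> \<alpha> j) (Y j) (h j) + (p' * (start \<sigma> \<alpha> j)\<^sup>2 - 2 * p * start \<sigma> \<alpha> j * Y j)"
  have total: "2 * p * total (\<sigma>, \<alpha>, h) = (\<Sum>j=1..n. ?G \<sigma> \<alpha> h j) - (\<Sum>j=1..n. p' * (X j)\<^sup>2 - 2 * p * X j * Y j)"
    if "\<sigma> permutes {1..n}" "\<alpha> \<in> zero_sum" for \<sigma> \<alpha> h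
  proof -
    have "2 * p * total (\<sigma>, \<alpha>, h) = 2 * p * energy \<sigma> \<alpha> + (\<Sum>j=1..n. 2 * p * area (start \<sigma> \<alpha> j) (Y j) (h j))"
      by (simp add: total_def total_area_def distrib_left sum_distrib_left)
    then show ?thesis unfolding energy_eq_start[OF that] by (simp add: sum.distrib)
  qed
  have "?G ?\<sigma> ?\<alpha> ?h i + ?G ?\<sigma> ?\<alpha> ?h l = ?G \<sigma> \<alpha> h i + ?G \<sigma> \<alpha> h l"
    using pair_conservation[OF hj[OF il(2)] hj[OF il(3)] refl pi pl]
    unfolding hi' hl' st by (simp add: algebra_simps)
  moreover have "(\<Sum>j\<in>{1..n} - {i, l}. ?G ?\<sigma> ?\<alpha> ?h j) = (\<Sum>j\<in>{1..n} - {i, l}. ?G \<sigma> \<alpha> h j)"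
  proof (rule sum.cong[OF refl])
    fix j assume "j \<in> {1..n} - {i, l}"
    then have j: "j \<noteq> i" "j \<noteq> l" by auto
    show "?G ?\<sigma> ?\<alpha> ?h j = ?G \<sigma> \<alpha> h j" unfolding hj'[OF j] st(3)[OF j] ..
  qed
  ultimately have "(\<Sum>j=1..n. ?G ?\<sigma> ?\<alpha> ?h j) = (\<Sum>j=1..n. ?G \<sigma> \<alpha> h j)"
    using sum_split_two[OF il, of "?G ?\<sigma> ?\<alpha> ?h"] sum_split_two[OF il, of "?G \<sigma> \<alpha> h"] by linarith
  then have "2 * p * total (?\<sigma>, ?\<alpha>, ?h) = 2 * p * total (\<sigma>, \<alpha>, h)"
    unfolding total[OF \<sigma> \<alpha>] total[OF \<sigma>' \<alpha>'] by linarith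
  then show "total (exchange_config s i l m (\<sigma>, \<alpha>, h)) = total (\<sigma>, \<alpha>, h)"
    using p_pos by (simp add: exchange_config_def)
  have "permutation \<sigma>" using \<sigma> by (rule permutes_imp_permutation[rotated]) simp
  then show "sign (fst (exchange_config s i l m (\<sigma>, \<alpha>, h))) = - sign \<sigma>"
    using il(1) by (simp add: exchange_config_def sign_compose permutation_swap_id sign_swap_id)
qed

text \<open>The second application picks the same point and the same pair of labels, because both choices
  depend only on \<open>meets h\<close> and on the labels at the chosen point. So it undoes the first one.\<close>

lemma flip_props:
  assumes c: "(\<sigma>, \<alpha>, h) \<in> configs" and meets: "meets h \<noteq> {}"
  shows "flip (\<sigma>, \<alpha>, h) \<in> configs" "total (flip (\<sigma>, \<alpha>, h)) = total (\<sigma>, \<alpha>, h)"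
    "sign (fst (flip (\<sigma>, \<alpha>, h))) = - sign \<sigma>" "meets (snd (snd (flip (\<sigma>, \<alpha>, h)))) = meets h"
    "flip (flip (\<sigma>, \<alpha>, h)) = (\<sigma>, \<alpha>, h)"
proof -
  obtain i q l q' where pair: "meeting_pair h = ((i, q), (l, q'))" and
    at: "(i, q) \<in> labels_at h (meeting h)" "(l, q') \<in> labels_at h (meeting h)" and
    il: "i \<noteq> l" "i \<in> {1..n}" "l \<in> {1..n}"
    using meeting_pairE[OF c meets] by blast
  define s where "s = fst (meeting h) - q * (p' - p)"
  define m where "m = q' - q"
  have flip: "flip (\<sigma>, \<alpha>, h) = exchange_config s i l m (\<sigma>, \<alpha>, h)"
    by (simp add: flip_def pair s_def m_def)
  have "h i (fst (meeting h) - q * (p' - p)) - q * p = h l (fst (meeting h) - q' * (p' - p)) - q' * p"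
    using at by (simp add: labels_at_def strand_def)
  then have meet: "h i s = h l (s - m * (p' - p)) - m * p"
    by (simp add: s_def m_def algebra_simps)
  note props = exchange_config_props[OF c il meet]
  show "flip (\<sigma>, \<alpha>, h) \<in> configs" "total (flip (\<sigma>, \<alpha>, h)) = total (\<sigma>, \<alpha>, h)"
    "sign (fst (flip (\<sigma>, \<alpha>, h))) = - sign \<sigma>"
    unfolding flip by (rule props)+
  define h' where "h' = exchange s i l m h"
  have snd: "snd (snd (flip (\<sigma>, \<alpha>, h))) = h'" by (simp add: flip exchange_config_def h'_def)
  have m': "meets h' = meets h" unfolding h'_def by (rule meets_exchange[OF il])
  then show "meets (snd (snd (flip (\<sigma>, \<alpha>, h)))) = meets h" by (simp add: snd)
  have "h i \<in> paths (start \<sigma> \<alpha> i) (Y i)" "h l \<in> paths (start \<sigma> \<alpha> l) (Y l)"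
    using c il by (auto simp: configs_def families_def)
  then have "labels_at h' (meeting h) = labels_at h (meeting h)"
    unfolding h'_def s_def m_def using labels_at_exchange_eq[OF il _ _ at] by simp
  moreover have "meeting h' = meeting h" by (simp add: meeting_def m')
  ultimately have "meeting h' = meeting h" "meeting_pair h' = meeting_pair h"
    by (simp_all add: meeting_pair_def)
  then have "flip (flip (\<sigma>, \<alpha>, h)) = exchange_config s i l m (flip (\<sigma>, \<alpha>, h))"
    unfolding flip_def[of "flip (\<sigma>, \<alpha>, h)"] snd by (simp add: pair s_def m_def)
  then show "flip (flip (\<sigma>, \<alpha>, h)) = (\<sigma>, \<alpha>, h)"
    unfolding flip by (simp add: exchange_config_involution[OF il(1)])
qed

lemma sum_sign_meeting_eq_0:
  "(\<Sum>c\<in>{c\<in>configs. total c = N \<and> meets (snd (snd c)) \<noteq> {}}. sign (fst c)) = 0"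
proof -
  let ?S = "{c\<in>configs. total c = N \<and> meets (snd (snd c)) \<noteq> {}}"
  have flip: "flip c \<in> ?S" "flip (flip c) = c" "sign (fst (flip c)) = - sign (fst c)" if "c \<in> ?S" for c
  proof -
    obtain \<sigma> \<alpha> h where c: "c = (\<sigma>, \<alpha>, h)" by (cases c)
    have "(\<sigma>, \<alpha>, h) \<in> configs" "meets h \<noteq> {}" "total c = N" using that by (simp_all add: c)
    note props = flip_props[OF this(1,2)]
    show "flip c \<in> ?S" using props \<open>total c = N\<close> \<open>meets h \<noteq> {}\<close> by (simp add: c)
    show "flip (flip c) = c" "sign (fst (flip c)) = - sign (fst c)" using props by (simp_all add: c)
  qed
  have "(\<Sum>c\<in>?S. sign (fst c)) = (\<Sum>c\<in>?S. sign (fst (flip c)))"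
  proof (rule sum.reindex_bij_witness[of _ flip flip])
    fix c assume c: "c \<in> ?S"
    show "flip (flip c) = c" "flip c \<in> ?S" using flip[OF c] by blast+
    then show "flip (flip c) = c" "flip c \<in> ?S" "sign (fst (flip (flip c))) = sign (fst c)" by simp_all
  qed
  also have "\<dots> = (\<Sum>c\<in>?S. - sign (fst c))"
    by (intro sum.cong refl flip(3))
  finally show ?thesis by (simp add: sum_negf)
qed

end

section \<open>Families without meetings\<close>

lemma bij_betw_PiE_map:
  assumes "\<And>j. j \<in> I \<Longrightarrow> bij_betw (f j) (A j) (B j)"
  shows "bij_betw (\<lambda>g. \<lambda>j\<in>I. f j (g j)) (Pi\<^sub>E I A) (Pi\<^sub>E I B)"
proof (rule bij_betw_byWitness[where f' = "\<lambda>g. \<lambda>j\<in>I. inv_into (A j) (f j) (g j)"])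
  show "\<forall>g\<in>Pi\<^sub>E I A. (\<lambda>j\<in>I. inv_into (A j) (f j) ((\<lambda>j\<in>I. f j (g j)) j)) = g"
  proof
    fix g assume g: "g \<in> Pi\<^sub>E I A"
    show "(\<lambda>j\<in>I. inv_into (A j) (f j) ((\<lambda>j\<in>I. f j (g j)) j)) = g"
    proof
      fix j
      show "(\<lambda>j\<in>I. inv_into (A j) (f j) ((\<lambda>j\<in>I. f j (g j)) j)) j = g j"
      proof (cases "j \<in> I")
        case True
        then have "g j \<in> A j" using g by auto
        then show ?thesis using True bij_betw_inv_into_left[OF assms[OF True]] by simp
      qed (use g in \<open>simp add: PiE_def extensional_def\<close>)
    qed
  qed
  show "\<forall>g\<in>Pi\<^sub>E I B. (\<lambda>j\<in>I. f j ((\<lambda>j\<in>I. inv_into (A j) (f j) (g j)) j)) = g"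
  proof
    fix g assume g: "g \<in> Pi\<^sub>E I B"
    show "(\<lambda>j\<in>I. f j ((\<lambda>j\<in>I. inv_into (A j) (f j) (g j)) j)) = g"
    proof
      fix j
      show "(\<lambda>j\<in>I. f j ((\<lambda>j\<in>I. inv_into (A j) (f j) (g j)) j)) j = g j"
      proof (cases "j \<in> I")
        case True
        then have "g j \<in> B j" using g by auto
        then show ?thesis using True bij_betw_inv_into_right[OF assms[OF True]] by simp
      qed (use g in \<open>simp add: PiE_def extensional_def\<close>)
    qed
  qed
  show "(\<lambda>g. \<lambda>j\<in>I. f j (g j)) ` Pi\<^sub>E I A \<subseteq> Pi\<^sub>E I B"
  proof (intro image_subsetI restrict_PiE_iff[THEN iffD2] ballI)
    fix g j assume "g \<in> Pi\<^sub>E I A" "j \<in> I"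
    then show "f j (g j) \<in> B j" using bij_betw_apply[OF assms[of j], of "g j"] by auto
  qed
  show "(\<lambda>g. \<lambda>j\<in>I. inv_into (A j) (f j) (g j)) ` Pi\<^sub>E I B \<subseteq> Pi\<^sub>E I A"
  proof (intro image_subsetI restrict_PiE_iff[THEN iffD2] ballI)
    fix g j assume "g \<in> Pi\<^sub>E I B" "j \<in> I"
    then show "inv_into (A j) (f j) (g j) \<in> A j"
      using bij_betw_apply[OF bij_betw_inv_into[OF assms[of j]], of "g j"] by auto
  qed
qed

lemma path_of_translate: "path_of x y \<mu> (t - c) - d = path_of (x - d) (y - c - d) \<mu> t"
  by (simp add: path_of_def algebra_simps)

text \<open>It suffices to compare the paths at the times when the lower one passes a row. By \<open>path_of_iff\<close>
  row \<open>j + b\<close> of \<open>\<nu>\<close> is then set against row \<open>j\<close> of \<open>\<mu>\<close>. The additional units in \<open>x\<close> and \<open>y\<close>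
  turn the weak inequality between parts into strict separation of the paths.\<close>

lemma path_of_less_iff:
  assumes \<mu>: "\<mu> \<in> fin_partitions" and \<nu>: "\<nu> \<in> fin_partitions"
    and x: "x = x' + int b + 1" and y: "y = y' + int a + 1"
  shows "(\<forall>t. path_of x' y' \<nu> t < path_of x y \<mu> t) \<longleftrightarrow> (\<forall>j. int (\<mu> j) \<ge> int (\<nu> (j + b)) - int a)"
proof
  assume less: "\<forall>t. path_of x' y' \<nu> t < path_of x y \<mu> t"
  show "\<forall>j. int (\<mu> j) \<ge> int (\<nu> (j + b)) - int a"
  proof (rule allI, rule ccontr)
    fix j assume n: "\<not> int (\<mu> j) \<ge> int (\<nu> (j + b)) - int a"
    define t where "t = int j + x - y - int (\<mu> j)"
    have "\<not> int j < path_of x y \<mu> t - x"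
      using path_of_iff[OF \<mu>, of j x y t] by (simp add: t_def)
    moreover have "int (j + b) < path_of x' y' \<nu> t - x'"
      using path_of_iff[OF \<nu>, of "j + b" x' y' t] n x y by (simp add: t_def)
    ultimately show False using less[rule_format, of t] x by simp
  qed
next
  assume cond: "\<forall>j. int (\<mu> j) \<ge> int (\<nu> (j + b)) - int a"
  show "\<forall>t. path_of x' y' \<nu> t < path_of x y \<mu> t"
  proof (rule allI, rule ccontr)
    fix t assume n: "\<not> path_of x' y' \<nu> t < path_of x y \<mu> t"
    define k where "k = nat (path_of x y \<mu> t - x)"
    have k: "int k = path_of x y \<mu> t - x" by (simp add: k_def path_of_def)
    have "\<not> int k < int (\<mu> k) + t + y - x" using path_of_iff[OF \<mu>, of k x y t] k by simp
    moreover have "int (k + b) < path_of x' y' \<nu> t - x'" using n k x by simp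
    then have "int (k + b) < int (\<nu> (k + b)) + t + y' - x'"
      using path_of_iff[OF \<nu>, of "k + b" x' y' t] by simp
    ultimately show False using cond[rule_format, of k] x y by simp
  qed
qed

lemma strict_mono_permutes_eq_id:
  assumes \<tau>: "\<tau> permutes {1..n::nat}" and mono: "\<And>i j. \<lbrakk>1 \<le> i; i < j; j \<le> n\<rbrakk> \<Longrightarrow> \<tau> i < \<tau> j"
  shows "\<tau> = id"
proof (rule permutes_natset_ge[OF \<tau>], rule ballI)
  have "1 \<le> i \<Longrightarrow> i \<le> n \<Longrightarrow> i \<le> \<tau> i" for i
  proof (induction i)
    case (Suc i)
    show ?case
    proof (cases "i = 0")
      case True
      then show ?thesis using permutes_in_image[OF \<tau>, of 1] Suc.prems by auto
    next
      case False
      then show ?thesis using Suc mono[of i "Suc i"] by simp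
    qed
  qed simp
  then show "i \<le> \<tau> i" if "i \<in> {1..n}" for i using that by simp
qed

context cylinder
begin

lemma strand_in_paths:
  assumes "h \<in> families \<sigma> \<alpha>" "l \<in> {1..n}"
  shows "strand h (l, m) \<in> paths (start \<sigma> \<alpha> l - m * p) (Y l - m * p')"
proof -
  have "h l \<in> paths (start \<sigma> \<alpha> l) (Y l)" using assms by (auto simp: families_def)
  from paths_translate[OF this, of "m * (p' - p)" "m * p"]
  have "(\<lambda>t. h l (t - m * (p' - p)) - m * p) \<in> paths (start \<sigma> \<alpha> l - m * p) (Y l - m * (p' - p) - m * p)" .
  moreover have "Y l - m * (p' - p) - m * p = Y l - m * p'" by (simp add: algebra_simps)
  moreover have "strand h (l, m) = (\<lambda>t. h l (t - m * (p' - p)) - m * p)"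
    by (simp add: strand_def fun_eq_iff)
  ultimately show ?thesis by simp
qed

lemma X_le: "\<lbrakk>1 \<le> i; i \<le> j; j \<le> n\<rbrakk> \<Longrightarrow> X j \<le> X i"
  using X_less[of i j] by (cases "i = j") auto

lemma Y_le: "\<lbrakk>1 \<le> i; i \<le> j; j \<le> n\<rbrakk> \<Longrightarrow> Y j \<le> Y i"
  using Y_less[of i j] by (cases "i = j") auto

lemma X_diff_less: "i \<in> {1..n} \<Longrightarrow> j \<in> {1..n} \<Longrightarrow> X i - X j < p"
  using X_le[of 1 i] X_le[of j n] X_wrap by simp

lemma Y_label_less:
  assumes "l \<in> {1..n}" "l' \<in> {1..n}" "m < m' \<or> m = m' \<and> l < l'"
  shows "Y l' - m' * p' < Y l - m * p'"
proof (cases "m < m'")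
  case True
  have "Y l' < Y l + p'" using Y_le[of 1 l'] Y_le[of l n] Y_wrap assms(1,2) by simp
  moreover have "(m' - m) * p' \<ge> 1 * p'" using True p'_pos by (intro mult_right_mono) auto
  ultimately show ?thesis by (simp add: algebra_simps)
next
  case False
  then show ?thesis using assms Y_less[of l l'] by simp
qed

lemma strand_less_if_no_meeting:
  assumes h: "h \<in> families \<sigma> \<alpha>" and no: "meets h = {}"
    and l: "l \<in> {1..n}" "l' \<in> {1..n}" "m < m' \<or> m = m' \<and> l < l'"
  shows "strand h (l', m') t < strand h (l, m) t"
proof (rule paths_less_if_no_meeting[OF strand_in_paths[OF h l(1)] strand_in_paths[OF h l(2)] Y_label_less[OF l]])
  fix t
  show "strand h (l, m) t \<noteq> strand h (l', m') t"
  proof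
    assume "strand h (l, m) t = strand h (l', m') t"
    then have "(l, m) \<in> labels_at h (t, strand h (l, m) t)" "(l', m') \<in> labels_at h (t, strand h (l, m) t)"
      using l by (simp_all add: labels_at_def)
    moreover have "(l, m) \<noteq> (l', m')" using l(3) by auto
    ultimately have "(t, strand h (l, m) t) \<in> meets h" unfolding meets_def by blast
    then show False using no by simp
  qed
qed

lemma start_less_if_no_meeting:
  assumes h: "h \<in> families \<sigma> \<alpha>" and no: "meets h = {}"
    and l: "l \<in> {1..n}" "l' \<in> {1..n}" "m < m' \<or> m = m' \<and> l < l'"
  shows "start \<sigma> \<alpha> l' - m' * p < start \<sigma> \<alpha> l - m * p"
  by (rule paths_less_imp_start_less[OF strand_in_paths[OF h l(1)] strand_in_paths[OF h l(2)]
        strand_less_if_no_meeting[OF h no l]])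

text \<open>The strands keep their order from the right to the left end. So the left ends, continued to all
  labels, decrease strictly: they lie in the same alcove as \<open>X\<close>, and an alcove contains only one
  point of an orbit. Concretely, \<open>\<alpha>\<close> is weakly decreasing with total variation at most one, so sum
  zero forces \<open>\<alpha> = 0\<close>, and then \<open>inv \<sigma>\<close> is increasing.\<close>

lemma no_meeting_imp_trivial:
  assumes c: "(\<sigma>, \<alpha>, h) \<in> configs" and no: "meets h = {}"
  shows "\<sigma> = id \<and> \<alpha> = (\<lambda>_. 0)"
proof -
  have \<sigma>: "\<sigma> permutes {1..n}" and \<alpha>: "\<alpha> \<in> zero_sum" and h: "h \<in> families \<sigma> \<alpha>"
    using c by (auto simp: configs_def)
  have inv: "inv \<sigma> permutes {1..n}" using \<sigma> by (rule permutes_inv)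
  have inv_mem: "inv \<sigma> i \<in> {1..n}" if "i \<in> {1..n}" for i using permutes_in_image[OF inv] that by blast
  have le: "\<alpha> j \<le> \<alpha> i" "\<alpha> i \<le> \<alpha> j + 1" if "i < j" "i \<in> {1..n}" "j \<in> {1..n}" for i j
  proof -
    have "X (inv \<sigma> j) + p * \<alpha> j < X (inv \<sigma> i) + p * \<alpha> i"
      using start_less_if_no_meeting[OF h no that(2,3), of 0 0] that(1) by (simp add: start_def)
    moreover have "X (inv \<sigma> i) - X (inv \<sigma> j) < p" by (intro X_diff_less inv_mem that)
    ultimately have "p * \<alpha> j < p * (\<alpha> i + 1)" by (simp add: algebra_simps)
    then show "\<alpha> j \<le> \<alpha> i" using p_pos by simp
    have "X (inv \<sigma> i) + p * \<alpha> i - p < X (inv \<sigma> j) + p * \<alpha> j"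
      using start_less_if_no_meeting[OF h no that(3,2), of 0 1] by (simp add: start_def)
    moreover have "X (inv \<sigma> j) - X (inv \<sigma> i) < p" by (intro X_diff_less inv_mem that)
    ultimately have "p * \<alpha> i < p * (\<alpha> j + 2)" by (simp add: algebra_simps)
    then show "\<alpha> i \<le> \<alpha> j + 1" using p_pos by simp
  qed
  have sum0: "(\<Sum>k=1..n. \<alpha> k) = 0" using \<alpha> by (simp add: zero_sum_def)
  have nonpos: "\<alpha> k \<le> 0" if k: "k \<in> {1..n}" for k
  proof (rule ccontr)
    assume "\<not> \<alpha> k \<le> 0"
    then have "\<alpha> 1 \<ge> 1" using le(1)[of 1 k] k by (cases "k = 1") auto
    then have "\<alpha> j \<ge> 0" if "j \<in> {1..n}" for j
      using le(2)[of 1 j] that by (cases "j = 1") auto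
    then have "(\<Sum>k=1..n. \<alpha> k) > 0"
      using \<open>\<not> \<alpha> k \<le> 0\<close> k by (intro sum_pos2[of _ k]) auto
    then show False using sum0 by simp
  qed
  have "(\<Sum>k=1..n. - \<alpha> k) = 0" using sum0 by (simp add: sum_negf)
  then have "\<forall>k\<in>{1..n}. - \<alpha> k = 0" using nonpos by (subst (asm) sum_nonneg_eq_0_iff) auto
  then have \<alpha>0: "\<alpha> = (\<lambda>_. 0)" using \<alpha> by (auto simp: zero_sum_def fun_eq_iff)
  have "inv \<sigma> = id"
  proof (rule strict_mono_permutes_eq_id[OF inv])
    fix i j :: nat assume ij: "1 \<le> i" "i < j" "j \<le> n"
    then have mem: "i \<in> {1..n}" "j \<in> {1..n}" by auto
    have "X (inv \<sigma> j) < X (inv \<sigma> i)"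
      using start_less_if_no_meeting[OF h no mem, of 0 0] ij by (simp add: start_def \<alpha>0)
    then show "inv \<sigma> i < inv \<sigma> j"
      using X_le[of "inv \<sigma> j" "inv \<sigma> i"] inv_mem[OF mem(1)] inv_mem[OF mem(2)]
      by (cases "inv \<sigma> i < inv \<sigma> j") auto
  qed
  then have "\<sigma> = id" using permutes_inv_inv[OF \<sigma>] by simp
  then show ?thesis using \<alpha>0 by simp
qed

lemma start_trivial: "start id (\<lambda>_. 0) = X"
  by (simp add: start_def fun_eq_iff)

lemma total_trivial: "total (id, (\<lambda>_. 0), h) = (\<Sum>j=1..n. area (X j) (Y j) (h j))"
  by (simp add: total_def total_area_def energy_def start_trivial)

text \<open>Neighbouring strands suffice because the labels, read turn by turn, are linearly ordered and
  running strictly above another strand is transitive.\<close>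

lemma no_meeting_if_neighbours:
  assumes step: "\<And>j t. 1 \<le> j \<Longrightarrow> j < n \<Longrightarrow> h (j + 1) t < h j t"
    and wrap: "\<And>t. h 1 (t - (p' - p)) - p < h n t"
  shows "meets h = {}"
proof -
  have dec: "1 \<le> i \<Longrightarrow> j \<le> n \<Longrightarrow> h j t < h i t" if "i < j" for i j t
    using that
  proof (induction j)
    case (Suc j)
    have "h (Suc j) t < h j t" using step[of j t] Suc by simp
    then show ?case using Suc by (cases "i = j") auto
  qed simp
  have le: "strand h (j, m) t \<le> strand h (i, m) t" if "1 \<le> i" "i \<le> j" "j \<le> n" for i j m t
    using dec[of i j] that by (cases "i = j") (auto simp: strand_def less_imp_le)
  have next_turn: "strand h (1, m + 1) t < strand h (n, m) t" for m t
    using wrap[of "t - m * (p' - p)"] by (simp add: strand_def algebra_simps)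
  have later: "strand h (l', m + 1 + int d) t < strand h (l, m) t"
    if "l \<in> {1..n}" "l' \<in> {1..n}" for l l' m d t
    using that(2)
  proof (induction d arbitrary: l')
    case 0
    show ?case using le[of 1 l' "m + 1" t] le[of l n m t] next_turn[of m t] that(1) 0 n_pos by simp
  next
    case (Suc d)
    have "strand h (1, m + 1 + int d) t < strand h (l, m) t" using Suc.IH[of 1] n_pos by simp
    moreover have "strand h (n, m + 1 + int d) t \<le> strand h (1, m + 1 + int d) t"
      using le[of 1 n] n_pos by simp
    moreover have "strand h (1, m + 1 + int d + 1) t < strand h (n, m + 1 + int d) t" by (rule next_turn)
    moreover have "strand h (l', m + 1 + int d + 1) t \<le> strand h (1, m + 1 + int d + 1) t"
      using le[of 1 l'] Suc.prems by simp
    ultimately have "strand h (l', m + 1 + int d + 1) t < strand h (l, m) t" by linarith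
    then show ?case by (simp add: algebra_simps)
  qed
  have less: "strand h (l', m') t < strand h (l, m) t"
    if "l \<in> {1..n}" "l' \<in> {1..n}" "m < m' \<or> m = m' \<and> l < l'" for l l' m m' t
  proof (cases "m < m'")
    case True
    then have "m' = m + 1 + int (nat (m' - m - 1))" by simp
    then show ?thesis using later[OF that(1,2), of m "nat (m' - m - 1)" t] by simp
  next
    case False
    then show ?thesis using that dec[of l l'] by (simp add: strand_def)
  qed
  have "v \<notin> meets h" for v
  proof
    assume "v \<in> meets h"
    then obtain A B where AB: "A \<in> labels_at h v" "B \<in> labels_at h v" "A \<noteq> B" by (auto simp: meets_def)
    obtain l m l' m' where eq: "A = (l, m)" "B = (l', m')" by (cases A, cases B) auto
    have lab: "l \<in> {1..n}" "l' \<in> {1..n}" "strand h (l, m) (fst v) = strand h (l', m') (fst v)"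
      using AB by (simp_all add: labels_at_def eq)
    have "(m < m' \<or> m = m' \<and> l < l') \<or> (m' < m \<or> m' = m \<and> l' < l)" using AB(3) eq by auto
    then show False
      using less[OF lab(1,2), of m m' "fst v"] less[OF lab(2,1), of m' m "fst v"] lab(3) by auto
  qed
  then show ?thesis by blast
qed

lemma neighbours_if_no_meeting:
  assumes h: "h \<in> families \<sigma> \<alpha>" and no: "meets h = {}"
  shows "1 \<le> j \<Longrightarrow> j < n \<Longrightarrow> h (j + 1) t < h j t" and "h 1 (t - (p' - p)) - p < h n t"
  using strand_less_if_no_meeting[OF h no, of j "j + 1" 0 0 t] strand_less_if_no_meeting[OF h no, of n 1 0 1 t] n_pos
  by (simp_all add: strand_def)

text \<open>The families with a meeting cancel, and the others have sign one.\<close>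

lemma sum_sign_configs:
  assumes fin: "finite {c\<in>configs. total c = N}"
  shows "(\<Sum>c\<in>{c\<in>configs. total c = N}. sign (fst c)) =
    int (card {h \<in> families id (\<lambda>_. 0). total_area id (\<lambda>_. 0) h = N \<and> meets h = {}})"
proof -
  let ?S = "{c\<in>configs. total c = N}"
  let ?M = "{c\<in>configs. total c = N \<and> meets (snd (snd c)) \<noteq> {}}"
  let ?H = "{h \<in> families id (\<lambda>_. 0). total_area id (\<lambda>_. 0) h = N \<and> meets h = {}}"
  have zero: "(\<lambda>_. 0) \<in> zero_sum" by (simp add: zero_sum_def)
  have tot: "total (id, (\<lambda>_. 0), h) = total_area id (\<lambda>_. 0) h" for h
    by (simp add: total_trivial total_area_def start_trivial)
  let ?e = "\<lambda>h. (id, (\<lambda>_. 0), h) :: config"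
  have "?S - ?M = ?e ` ?H"
  proof (intro equalityI subsetI)
    fix c assume c: "c \<in> ?S - ?M"
    obtain \<sigma> \<alpha> h where eq: "c = (\<sigma>, \<alpha>, h)" by (cases c)
    have h: "(\<sigma>, \<alpha>, h) \<in> configs" "meets h = {}" "total (\<sigma>, \<alpha>, h) = N" using c by (auto simp: eq)
    have "\<sigma> = id" "\<alpha> = (\<lambda>_. 0)" using no_meeting_imp_trivial[OF h(1,2)] by auto
    then show "c \<in> ?e ` ?H" using h tot by (auto simp: eq configs_def)
  next
    fix c assume "c \<in> ?e ` ?H"
    then show "c \<in> ?S - ?M" using zero tot by (auto simp: configs_def permutes_id)
  qed
  then have "(\<Sum>c\<in>?S - ?M. sign (fst c)) = (\<Sum>h\<in>?H. sign id)"
    by (simp add: sum.reindex inj_on_def)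
  moreover have "(\<Sum>c\<in>?S. sign (fst c)) = (\<Sum>c\<in>?S - ?M. sign (fst c)) + (\<Sum>c\<in>?M. sign (fst c))"
    by (rule sum.subset_diff) (use fin in auto)
  ultimately show ?thesis using sum_sign_meeting_eq_0[of N] by (simp add: sign_id)
qed

section \<open>Signed counts of partitions\<close>

lemma families_bij:
  "bij_betw (\<lambda>\<Lambda>. \<lambda>j\<in>{1..n}. path_of (start \<sigma> \<alpha> j) (Y j) (\<Lambda> j))
     ({1..n} \<rightarrow>\<^sub>E fin_partitions) (families \<sigma> \<alpha>)"
  unfolding families_def
proof (rule bij_betw_PiE_map)
  fix j
  show "bij_betw (path_of (start \<sigma> \<alpha> j) (Y j)) fin_partitions (paths (start \<sigma> \<alpha> j) (Y j))"
    using inj_on_path_of path_of_mem path_of_surj unfolding bij_betw_def by fast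
qed

lemma total_area_path_of:
  assumes "\<Lambda> \<in> {1..n} \<rightarrow>\<^sub>E fin_partitions"
  shows "total_area \<sigma> \<alpha> (\<lambda>j\<in>{1..n}. path_of (start \<sigma> \<alpha> j) (Y j) (\<Lambda> j)) = int (\<Sum>j=1..n. partition_size (\<Lambda> j))"
proof -
  have "total_area \<sigma> \<alpha> (\<lambda>j\<in>{1..n}. path_of (start \<sigma> \<alpha> j) (Y j) (\<Lambda> j)) = (\<Sum>j=1..n. int (partition_size (\<Lambda> j)))"
    unfolding total_area_def
  proof (rule sum.cong[OF refl])
    fix j assume j: "j \<in> {1..n}"
    then have "\<Lambda> j \<in> fin_partitions" using assms by auto
    from area_path_of[OF this, of "start \<sigma> \<alpha> j" "Y j"]
    show "area (start \<sigma> \<alpha> j) (Y j) ((\<lambda>j\<in>{1..n}. path_of (start \<sigma> \<alpha> j) (Y j) (\<Lambda> j)) j) = int (partition_size (\<Lambda> j))"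
      using j by simp
  qed
  then show ?thesis by simp
qed

lemma bij_betw_families_area:
  "bij_betw (\<lambda>\<Lambda>. \<lambda>j\<in>{1..n}. path_of (start \<sigma> \<alpha> j) (Y j) (\<Lambda> j))
     {\<Lambda> \<in> {1..n} \<rightarrow>\<^sub>E fin_partitions. P \<Lambda> \<and> int (\<Sum>j=1..n. partition_size (\<Lambda> j)) = N}
     {h \<in> families \<sigma> \<alpha>. Q h \<and> total_area \<sigma> \<alpha> h = N}"
  if PQ: "\<And>\<Lambda>. \<Lambda> \<in> {1..n} \<rightarrow>\<^sub>E fin_partitions \<Longrightarrow> Q (\<lambda>j\<in>{1..n}. path_of (start \<sigma> \<alpha> j) (Y j) (\<Lambda> j)) \<longleftrightarrow> P \<Lambda>"
proof -
  let ?f = "\<lambda>\<Lambda>. \<lambda>j\<in>{1..n}. path_of (start \<sigma> \<alpha> j) (Y j) (\<Lambda> j)"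
  let ?T = "{\<Lambda> \<in> {1..n} \<rightarrow>\<^sub>E fin_partitions. P \<Lambda> \<and> int (\<Sum>j=1..n. partition_size (\<Lambda> j)) = N}"
  have bij: "bij_betw ?f ({1..n} \<rightarrow>\<^sub>E fin_partitions) (families \<sigma> \<alpha>)" by (rule families_bij)
  have "?f ` ?T = {h \<in> families \<sigma> \<alpha>. Q h \<and> total_area \<sigma> \<alpha> h = N}"
  proof (intro equalityI subsetI)
    fix h assume "h \<in> ?f ` ?T"
    then obtain \<Lambda> where \<Lambda>: "\<Lambda> \<in> ?T" "h = ?f \<Lambda>" by blast
    then have "\<Lambda> \<in> {1..n} \<rightarrow>\<^sub>E fin_partitions" by blast
    moreover from this have "?f \<Lambda> \<in> families \<sigma> \<alpha>" using bij_betwE[OF bij] by blast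
    ultimately show "h \<in> {h \<in> families \<sigma> \<alpha>. Q h \<and> total_area \<sigma> \<alpha> h = N}"
      using \<Lambda> total_area_path_of[of \<Lambda> \<sigma> \<alpha>] PQ[of \<Lambda>] by simp
  next
    fix h assume h: "h \<in> {h \<in> families \<sigma> \<alpha>. Q h \<and> total_area \<sigma> \<alpha> h = N}"
    then have "h \<in> ?f ` ({1..n} \<rightarrow>\<^sub>E fin_partitions)" using bij by (simp add: bij_betw_def)
    then obtain \<Lambda> where \<Lambda>: "\<Lambda> \<in> {1..n} \<rightarrow>\<^sub>E fin_partitions" "h = ?f \<Lambda>" by blast
    then have "\<Lambda> \<in> ?T" using h total_area_path_of[OF \<Lambda>(1), of \<sigma> \<alpha>] PQ[OF \<Lambda>(1)] by simp
    then show "h \<in> ?f ` ?T" using \<Lambda>(2) by blast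
  qed
  moreover have "inj_on ?f ?T" by (rule inj_on_subset[OF bij_betw_imp_inj_on[OF bij]]) auto
  ultimately show ?thesis by (simp add: bij_betw_def)
qed

text \<open>By \<open>energy_eq_start\<close> the energy is a quadratic function of the left ends with positive
  definite leading part. Completing the square bounds every coordinate.\<close>

lemma finite_energy_le:
  assumes \<sigma>: "\<sigma> permutes {1..n}"
  shows "finite {\<alpha>\<in>zero_sum. energy \<sigma> \<alpha> \<le> N}"
proof -
  define C where "C = (\<Sum>j=1..n. p' * (X j)\<^sup>2 - 2 * p * X j * Y j)"
  define K where "K = 2 * p * N + C + (\<Sum>j=1..n. (p * Y j)\<^sup>2)"
  define R where "R = K + (\<Sum>j=1..n. \<bar>p * Y j\<bar> + \<bar>X (inv \<sigma> j)\<bar>)"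
  have bound: "\<alpha> k \<in> {- R..R}" if \<alpha>: "\<alpha> \<in> zero_sum" "energy \<sigma> \<alpha> \<le> N" and k: "k \<in> {1..n}" for \<alpha> k
  proof -
    let ?s = "start \<sigma> \<alpha>"
    have "(\<Sum>j=1..n. (?s j - p * Y j)\<^sup>2) \<le> (\<Sum>j=1..n. (p' * (?s j)\<^sup>2 - 2 * p * ?s j * Y j) + (p * Y j)\<^sup>2)"
    proof (rule sum_mono)
      fix j
      have "1 * (?s j)\<^sup>2 \<le> p' * (?s j)\<^sup>2" using p'_pos by (intro mult_right_mono) auto
      then show "(?s j - p * Y j)\<^sup>2 \<le> (p' * (?s j)\<^sup>2 - 2 * p * ?s j * Y j) + (p * Y j)\<^sup>2"
        by (simp add: power2_eq_square algebra_simps)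
    qed
    also have "\<dots> = 2 * p * energy \<sigma> \<alpha> + C + (\<Sum>j=1..n. (p * Y j)\<^sup>2)"
      unfolding energy_eq_start[OF \<sigma> \<alpha>(1)] C_def by (simp add: sum.distrib)
    also have "\<dots> \<le> K" using \<alpha>(2) p_pos by (simp add: K_def)
    finally have "(\<Sum>j=1..n. (?s j - p * Y j)\<^sup>2) \<le> K" .
    moreover have "(?s k - p * Y k)\<^sup>2 \<le> (\<Sum>j=1..n. (?s j - p * Y j)\<^sup>2)"
      using k by (intro member_le_sum) auto
    moreover have "\<bar>z\<bar> \<le> z\<^sup>2" for z :: int
      using self_le_power[of "\<bar>z\<bar>" 2] by (cases "z = 0") auto
    ultimately have 1: "\<bar>?s k - p * Y k\<bar> \<le> K" by (meson order_trans)
    have 2: "\<bar>p * Y k\<bar> + \<bar>X (inv \<sigma> k)\<bar> \<le> (\<Sum>j=1..n. \<bar>p * Y j\<bar> + \<bar>X (inv \<sigma> j)\<bar>)"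
      using k by (intro member_le_sum) auto
    have "1 * \<bar>\<alpha> k\<bar> \<le> p * \<bar>\<alpha> k\<bar>" using p_pos by (intro mult_right_mono) auto
    also have "\<dots> = \<bar>p * \<alpha> k\<bar>" using p_pos by (simp add: abs_mult)
    also have "\<dots> \<le> R" using 1 2 unfolding R_def start_def by linarith
    finally show ?thesis by auto
  qed
  show ?thesis
  proof (rule finite_subset)
    show "{\<alpha>\<in>zero_sum. energy \<sigma> \<alpha> \<le> N} \<subseteq>
        {\<alpha>. \<forall>k. (k \<in> {1..n} \<longrightarrow> \<alpha> k \<in> {- R..R}) \<and> (k \<notin> {1..n} \<longrightarrow> \<alpha> k = 0)}"
      using bound by (auto simp: zero_sum_def)
  qed (rule finite_set_of_finite_funs; simp)
qed

definition tuple_count :: "int \<Rightarrow> nat" where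
  "tuple_count N = card {\<Lambda> \<in> {1..n} \<rightarrow>\<^sub>E fin_partitions. int (\<Sum>j=1..n. partition_size (\<Lambda> j)) = N}"

text \<open>For fixed \<open>\<sigma>\<close> and \<open>\<alpha>\<close> the \<open>n\<close> paths are independent of each other, so they are an arbitrary
  tuple of partitions, whose size is what the energy leaves of \<open>N\<close>.\<close>

lemma sum_sign_configs_eq:
  assumes fin: "\<And>m. finite {\<Lambda> \<in> {1..n} \<rightarrow>\<^sub>E fin_partitions. (\<Sum>j=1..n. partition_size (\<Lambda> j)) = m}"
  shows "finite {c\<in>configs. total c = N}"
    and "(\<Sum>c\<in>{c\<in>configs. total c = N}. sign (fst c)) =
      (\<Sum>\<sigma> | \<sigma> permutes {1..n}. sign \<sigma> * (\<Sum>\<alpha>\<in>{\<alpha>\<in>zero_sum. energy \<sigma> \<alpha> \<le> N}. int (tuple_count (N - energy \<sigma> \<alpha>))))"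
proof -
  let ?F = "\<lambda>\<sigma> \<alpha>. {h \<in> families \<sigma> \<alpha>. total_area \<sigma> \<alpha> h = N - energy \<sigma> \<alpha>}"
  let ?A = "\<lambda>\<sigma>. {\<alpha>\<in>zero_sum. energy \<sigma> \<alpha> \<le> N}"
  have T: "finite {\<Lambda> \<in> {1..n} \<rightarrow>\<^sub>E fin_partitions. int (\<Sum>j=1..n. partition_size (\<Lambda> j)) = m}" for m
    by (rule finite_subset[OF _ fin[of "nat m"]]) (auto simp del: of_nat_sum)
  have bij: "bij_betw (\<lambda>\<Lambda>. \<lambda>j\<in>{1..n}. path_of (start \<sigma> \<alpha> j) (Y j) (\<Lambda> j))
     {\<Lambda> \<in> {1..n} \<rightarrow>\<^sub>E fin_partitions. int (\<Sum>j=1..n. partition_size (\<Lambda> j)) = N - energy \<sigma> \<alpha>} (?F \<sigma> \<alpha>)" for \<sigma> \<alpha>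
    using bij_betw_families_area[of "\<lambda>_. True" \<sigma> \<alpha> "\<lambda>_. True" "N - energy \<sigma> \<alpha>"] by simp
  have finF: "finite (?F \<sigma> \<alpha>)" and cardF: "card (?F \<sigma> \<alpha>) = tuple_count (N - energy \<sigma> \<alpha>)" for \<sigma> \<alpha>
    using bij_betw_finite[OF bij[of \<sigma> \<alpha>]] T bij_betw_same_card[OF bij[of \<sigma> \<alpha>]] by (simp_all add: tuple_count_def)
  have finP: "finite {\<sigma>. \<sigma> permutes {1..n}}" by (rule finite_permutations) simp
  have nonneg: "total_area \<sigma> \<alpha> h \<ge> 0" if "h \<in> families \<sigma> \<alpha>" for \<sigma> \<alpha> h
  proof -
    let ?f = "\<lambda>\<Lambda>. \<lambda>j\<in>{1..n}. path_of (start \<sigma> \<alpha> j) (Y j) (\<Lambda> j)"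
    have "h \<in> ?f ` ({1..n} \<rightarrow>\<^sub>E fin_partitions)"
      using that bij_betw_imp_surj_on[OF families_bij[of \<sigma> \<alpha>]] by simp
    then obtain \<Lambda> where \<Lambda>: "\<Lambda> \<in> {1..n} \<rightarrow>\<^sub>E fin_partitions" "h = ?f \<Lambda>" by blast
    show ?thesis unfolding \<Lambda>(2) total_area_path_of[OF \<Lambda>(1), of \<sigma> \<alpha>] by (rule of_nat_0_le_iff)
  qed
  have eq: "{c\<in>configs. total c = N} = (SIGMA \<sigma>:{\<sigma>. \<sigma> permutes {1..n}}. SIGMA \<alpha>:?A \<sigma>. ?F \<sigma> \<alpha>)"
    using nonneg by (force simp: configs_def total_def)
  show "finite {c\<in>configs. total c = N}"
    unfolding eq using finP finite_energy_le finF by (intro finite_SigmaI) auto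
  have "(\<Sum>c\<in>{c\<in>configs. total c = N}. sign (fst c)) =
      (\<Sum>\<sigma> | \<sigma> permutes {1..n}. \<Sum>c\<in>(SIGMA \<alpha>:?A \<sigma>. ?F \<sigma> \<alpha>). sign \<sigma>)"
    unfolding eq using finP finite_energy_le finF
    by (subst sum.Sigma) (auto intro!: finite_SigmaI simp: case_prod_unfold)
  also have "\<dots> = (\<Sum>\<sigma> | \<sigma> permutes {1..n}. sign \<sigma> * (\<Sum>\<alpha>\<in>?A \<sigma>. int (tuple_count (N - energy \<sigma> \<alpha>))))"
  proof (rule sum.cong[OF refl])
    fix \<sigma> assume "\<sigma> \<in> {\<sigma>. \<sigma> permutes {1..n}}"
    then have "card (SIGMA \<alpha>:?A \<sigma>. ?F \<sigma> \<alpha>) = (\<Sum>\<alpha>\<in>?A \<sigma>. card (?F \<sigma> \<alpha>))"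
      using finite_energy_le finF by (intro card_SigmaI) auto
    then show "(\<Sum>c\<in>(SIGMA \<alpha>:?A \<sigma>. ?F \<sigma> \<alpha>). sign \<sigma>) = sign \<sigma> * (\<Sum>\<alpha>\<in>?A \<sigma>. int (tuple_count (N - energy \<sigma> \<alpha>)))"
      by (simp add: cardF)
  qed
  finally show "(\<Sum>c\<in>{c\<in>configs. total c = N}. sign (fst c)) =
      (\<Sum>\<sigma> | \<sigma> permutes {1..n}. sign \<sigma> * (\<Sum>\<alpha>\<in>?A \<sigma>. int (tuple_count (N - energy \<sigma> \<alpha>))))" .
qed

lemma card_no_meeting:
  fixes a b :: "nat \<Rightarrow> nat"
  assumes X: "\<And>i. 1 \<le> i \<Longrightarrow> i < n \<Longrightarrow> X i = X (i + 1) + int (b i) + 1" "X n = X 1 - p + int (b n) + 1"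
    and Y: "\<And>i. 1 \<le> i \<Longrightarrow> i < n \<Longrightarrow> Y i = Y (i + 1) + int (a i) + 1" "Y n = Y 1 - p' + int (a n) + 1"
  shows "card {h \<in> families id (\<lambda>_. 0). total_area id (\<lambda>_. 0) h = N \<and> meets h = {}} =
    card {\<Lambda> \<in> partition_tuples n a b. int (\<Sum>j=1..n. partition_size (\<Lambda> j)) = N}"
proof -
  let ?f = "\<lambda>\<Lambda>. \<lambda>j\<in>{1..n}. path_of (X j) (Y j) (\<Lambda> j)"
  let ?P = "\<lambda>\<Lambda>. \<forall>i\<in>{1..n}. \<forall>j. int (\<Lambda> i j) \<ge> int (\<Lambda> (if i = n then 1 else i + 1) (j + b i)) - int (a i)"
  have st: "start id (\<lambda>_. 0) j = X j" for j by (simp add: start_trivial)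
  have "meets (?f \<Lambda>) = {} \<longleftrightarrow> ?P \<Lambda>" if \<Lambda>: "\<Lambda> \<in> {1..n} \<rightarrow>\<^sub>E fin_partitions" for \<Lambda>
  proof -
    have mem: "\<Lambda> j \<in> fin_partitions" if "j \<in> {1..n}" for j using \<Lambda> that by auto
    have fam: "?f \<Lambda> \<in> families id (\<lambda>_. 0)"
      using bij_betwE[OF families_bij[of id "\<lambda>_. 0"]] \<Lambda> unfolding st by blast
    have step: "(\<forall>t. ?f \<Lambda> (i + 1) t < ?f \<Lambda> i t) \<longleftrightarrow>
        (\<forall>j. int (\<Lambda> i j) \<ge> int (\<Lambda> (i + 1) (j + b i)) - int (a i))" if "1 \<le> i" "i < n" for i
      using path_of_less_iff[OF mem[of i] mem[of "i + 1"] X(1)[OF that] Y(1)[OF that]] that by simp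
    have wrap: "(\<forall>t. ?f \<Lambda> 1 (t - (p' - p)) - p < ?f \<Lambda> n t) \<longleftrightarrow>
        (\<forall>j. int (\<Lambda> n j) \<ge> int (\<Lambda> 1 (j + b n)) - int (a n))"
    proof -
      have "?f \<Lambda> 1 (t - (p' - p)) - p = path_of (X 1 - p) (Y 1 - p') (\<Lambda> 1) t" for t
        using path_of_translate[of "X 1" "Y 1" "\<Lambda> 1" t "p' - p" p] n_pos by simp
      then show ?thesis using path_of_less_iff[OF mem[of n] mem[of 1] X(2) Y(2)] n_pos by simp
    qed
    show ?thesis
    proof
      assume no: "meets (?f \<Lambda>) = {}"
      show "?P \<Lambda>"
      proof
        fix i assume i: "i \<in> {1..n}"
        show "\<forall>j. int (\<Lambda> i j) \<ge> int (\<Lambda> (if i = n then 1 else i + 1) (j + b i)) - int (a i)"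
        proof (cases "i = n")
          case True
          then show ?thesis using wrap neighbours_if_no_meeting(2)[OF fam no] by simp
        next
          case False
          then show ?thesis using step[of i] neighbours_if_no_meeting(1)[OF fam no, of i] i by simp
        qed
      qed
    next
      assume P: "?P \<Lambda>"
      show "meets (?f \<Lambda>) = {}"
      proof (rule no_meeting_if_neighbours)
        fix j t assume j: "1 \<le> j" "j < n"
        then have "\<forall>k. int (\<Lambda> j k) \<ge> int (\<Lambda> (j + 1) (k + b j)) - int (a j)"
          using P[rule_format, of j] by simp
        then show "?f \<Lambda> (j + 1) t < ?f \<Lambda> j t" using step[OF j] by blast
      next
        fix t
        have "\<forall>k. int (\<Lambda> n k) \<ge> int (\<Lambda> 1 (k + b n)) - int (a n)"
          using P[rule_format, of n] n_pos by simp
        then show "?f \<Lambda> 1 (t - (p' - p)) - p < ?f \<Lambda> n t" using wrap by blast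
      qed
    qed
  qed
  then have "bij_betw ?f {\<Lambda> \<in> {1..n} \<rightarrow>\<^sub>E fin_partitions. ?P \<Lambda> \<and> int (\<Sum>j=1..n. partition_size (\<Lambda> j)) = N}
      {h \<in> families id (\<lambda>_. 0). meets h = {} \<and> total_area id (\<lambda>_. 0) h = N}"
    using bij_betw_families_area[of "\<lambda>h. meets h = {}" id "\<lambda>_. 0" ?P N] unfolding st by blast
  then have "card {h \<in> families id (\<lambda>_. 0). meets h = {} \<and> total_area id (\<lambda>_. 0) h = N} =
      card {\<Lambda> \<in> {1..n} \<rightarrow>\<^sub>E fin_partitions. ?P \<Lambda> \<and> int (\<Sum>j=1..n. partition_size (\<Lambda> j)) = N}"
    by (rule bij_betw_same_card[symmetric])
  moreover have "{\<Lambda> \<in> {1..n} \<rightarrow>\<^sub>E fin_partitions. ?P \<Lambda> \<and> int (\<Sum>j=1..n. partition_size (\<Lambda> j)) = N} =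
      {\<Lambda> \<in> partition_tuples n a b. int (\<Sum>j=1..n. partition_size (\<Lambda> j)) = N}"
    unfolding partition_tuples_def by blast
  ultimately show ?thesis by (simp only: conj_commute)
qed

end

section \<open>Theta series as formal Laurent series\<close>

text \<open>The partial sums over finite sets that contain all exponents up to \<open>K\<close> agree with the limit up to
  degree \<open>K\<close>, so their distance to it is at most \<open>2\<close> to the power \<open>- K\<close>. The lower bound \<open>L\<close> exists
  because only finitely many exponents are negative.\<close>

lemma has_sum_fls_X_intpow:
  fixes f :: "'a \<Rightarrow> int"
  assumes fin: "\<And>N. finite {\<alpha>\<in>A. f \<alpha> \<le> N}"
  defines "S \<equiv> Abs_fls (\<lambda>N. of_nat (card {\<alpha>\<in>A. f \<alpha> = N})) :: 'b :: ring_1 fls"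
  obtains L where "\<And>N. fls_nth S N = of_nat (card {\<alpha>\<in>A. f \<alpha> = N})" "\<And>N. N < L \<Longrightarrow> fls_nth S N = 0"
    "((\<lambda>\<alpha>. fls_X_intpow (f \<alpha>)) has_sum S) A"
proof -
  define L where "L = Min (insert 0 (f ` {\<alpha>\<in>A. f \<alpha> \<le> 0}))"
  have "finite (f ` {\<alpha>\<in>A. f \<alpha> \<le> 0})" using fin by simp
  then have L: "L \<le> f \<alpha>" if "\<alpha> \<in> A" for \<alpha>
    unfolding L_def using that by (cases "f \<alpha> \<le> 0") (auto simp: Min_le_iff)
  have empty: "{\<alpha>\<in>A. f \<alpha> = N} = {}" if "N < L" for N using L that by force
  have S: "fls_nth S N = of_nat (card {\<alpha>\<in>A. f \<alpha> = N})" for N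
    unfolding S_def
  proof (rule nth_Abs_fls_lower_bound, intro allI impI)
    show "of_nat (card {\<alpha>\<in>A. f \<alpha> = k}) = (0 :: 'b)" if "k < L" for k unfolding empty[OF that] by simp
  qed
  have "((\<lambda>\<alpha>. fls_X_intpow (f \<alpha>)) has_sum S) A"
    unfolding has_sum_def tendsto_iff
  proof (intro allI impI)
    fix e :: real assume "e > 0"
    then obtain K where K: "(1 / 2) ^ K < e" using real_arch_pow_inv[of e "1/2"] by auto
    let ?B = "{\<alpha>\<in>A. f \<alpha> \<le> int K}"
    have "\<forall>\<^sub>F T in finite_subsets_at_top A. finite T \<and> ?B \<subseteq> T \<and> T \<subseteq> A"
      using fin[of "int K"] by (subst eventually_finite_subsets_at_top) blast
    then show "\<forall>\<^sub>F T in finite_subsets_at_top A. dist (\<Sum>\<alpha>\<in>T. fls_X_intpow (f \<alpha>)) S < e"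
    proof eventually_elim
      case (elim T)
      let ?D = "(\<Sum>\<alpha>\<in>T. fls_X_intpow (f \<alpha>)) - S"
      have zero: "fls_nth ?D k = 0" if "k < int K + 1" for k
      proof -
        have "fls_nth (\<Sum>\<alpha>\<in>T. fls_X_intpow (f \<alpha>) :: 'b fls) k = (\<Sum>\<alpha>\<in>T. if f \<alpha> = k then 1 else 0)"
          by (simp add: fls_nth_sum) (intro sum.cong, auto)
        also have "\<dots> = of_nat (card {\<alpha>\<in>T. f \<alpha> = k})"
          using elim by (simp flip: sum.inter_filter)
        also have "{\<alpha>\<in>T. f \<alpha> = k} = {\<alpha>\<in>A. f \<alpha> = k}" using elim that by auto
        finally show ?thesis by (simp add: S)
      qed
      show ?case
      proof (cases "(\<Sum>\<alpha>\<in>T. fls_X_intpow (f \<alpha>)) = S")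
        case True
        then show ?thesis using \<open>e > 0\<close> by simp
      next
        case False
        then have "int K + 1 \<le> fls_subdegree ?D" using zero by (intro fls_subdegree_geI) auto
        then have sub: "fls_subdegree ?D \<ge> 0" "K \<le> nat (fls_subdegree ?D)" by simp_all
        have "dist (\<Sum>\<alpha>\<in>T. fls_X_intpow (f \<alpha>)) S = (1 / 2) ^ nat (fls_subdegree ?D)"
          using False sub(1) by (simp add: dist_fls_def power_one_over inverse_eq_divide)
        also have "\<dots> \<le> (1 / 2) ^ K" using sub(2) by (intro power_decreasing) auto
        finally show ?thesis using K by linarith
      qed
    qed
  qed
  then show thesis using that[of L] S empty by simp
qed

lemma fps_to_fls_times_nth:
  fixes F :: "'a :: comm_ring_1 fps"
  assumes "\<And>k. k < L \<Longrightarrow> fls_nth B k = 0"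
  shows "fls_nth (fps_to_fls F * B) N = (\<Sum>k=L..N. fps_nth F (nat (N - k)) * fls_nth B k)"
proof -
  let ?f = "fps_to_fls F"
  let ?df = "fls_subdegree ?f" and ?dg = "fls_subdegree B"
  let ?U = "{min L ?dg..max N (N - ?df)}"
  have "fls_nth (?f * B) N = (\<Sum>i=?df..N - ?dg. fls_nth ?f i * fls_nth B (N - i))"
    by (rule fls_times_nth)
  also have "\<dots> = (\<Sum>k=?dg..N - ?df. fls_nth ?f (N - k) * fls_nth B k)"
    by (rule sum.reindex_bij_witness[of _ "\<lambda>k. N - k" "\<lambda>k. N - k"]) auto
  also have "\<dots> = (\<Sum>k\<in>?U. fls_nth ?f (N - k) * fls_nth B k)"
  proof (rule sum.mono_neutral_left)
    show "\<forall>k\<in>?U - {?dg..N - ?df}. fls_nth ?f (N - k) * fls_nth B k = 0"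
    proof
      fix k assume "k \<in> ?U - {?dg..N - ?df}"
      then have "k < ?dg \<or> N - k < ?df" by auto
      then show "fls_nth ?f (N - k) * fls_nth B k = 0"
        using fls_eq0_below_subdegree[of k B] fls_eq0_below_subdegree[of "N - k" ?f] by auto
    qed
  qed auto
  also have "\<dots> = (\<Sum>k=L..N. fls_nth ?f (N - k) * fls_nth B k)"
    by (rule sum.mono_neutral_right) (use assms in auto)
  also have "\<dots> = (\<Sum>k=L..N. fps_nth F (nat (N - k)) * fls_nth B k)"
    by (intro sum.cong) auto
  finally show ?thesis .
qed

lemma fps_to_fls_times_theta_nth:
  fixes f :: "'a \<Rightarrow> int" and F :: "'b :: comm_ring_1 fps"
  assumes fin: "\<And>N. finite {\<alpha>\<in>A. f \<alpha> \<le> N}"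
  shows "fls_nth (fps_to_fls F * (\<Sum>\<^sub>\<infinity>\<alpha>\<in>A. fls_X_intpow (f \<alpha>))) N =
    (\<Sum>\<alpha>\<in>{\<alpha>\<in>A. f \<alpha> \<le> N}. fps_nth F (nat (N - f \<alpha>)))"
proof -
  define S where "S = (Abs_fls (\<lambda>N. of_nat (card {\<alpha>\<in>A. f \<alpha> = N})) :: 'b fls)"
  obtain L where S: "\<And>N. fls_nth S N = of_nat (card {\<alpha>\<in>A. f \<alpha> = N})" "\<And>N. N < L \<Longrightarrow> fls_nth S N = 0"
    "((\<lambda>\<alpha>. fls_X_intpow (f \<alpha>)) has_sum S) A"
    using has_sum_fls_X_intpow[of A f, OF fin] unfolding S_def by blast
  define L' where "L' = Min (insert L (f ` {\<alpha>\<in>A. f \<alpha> \<le> N}))"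
  have fin': "finite (f ` {\<alpha>\<in>A. f \<alpha> \<le> N})" using fin by simp
  have L': "L' \<le> L" "\<And>\<alpha>. \<alpha> \<in> A \<Longrightarrow> f \<alpha> \<le> N \<Longrightarrow> L' \<le> f \<alpha>"
    using fin' by (auto simp: L'_def intro!: Min_le)
  have "fls_nth (fps_to_fls F * (\<Sum>\<^sub>\<infinity>\<alpha>\<in>A. fls_X_intpow (f \<alpha>))) N = fls_nth (fps_to_fls F * S) N"
    using infsumI[OF S(3)] by simp
  also have "\<dots> = (\<Sum>k=L'..N. fps_nth F (nat (N - k)) * fls_nth S k)"
    by (rule fps_to_fls_times_nth) (use S(2) L'(1) in auto)
  also have "\<dots> = (\<Sum>k=L'..N. \<Sum>\<alpha> | \<alpha> \<in> {\<alpha>\<in>A. f \<alpha> \<le> N} \<and> f \<alpha> = k. fps_nth F (nat (N - f \<alpha>)))"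
  proof (rule sum.cong[OF refl])
    fix k assume k: "k \<in> {L'..N}"
    then have "{\<alpha>. \<alpha> \<in> {\<alpha>\<in>A. f \<alpha> \<le> N} \<and> f \<alpha> = k} = {\<alpha>\<in>A. f \<alpha> = k}" by auto
    then show "fps_nth F (nat (N - k)) * fls_nth S k =
        (\<Sum>\<alpha> | \<alpha> \<in> {\<alpha>\<in>A. f \<alpha> \<le> N} \<and> f \<alpha> = k. fps_nth F (nat (N - f \<alpha>)))"
      by (simp add: S(1) mult.commute)
  qed
  also have "\<dots> = (\<Sum>\<alpha>\<in>{\<alpha>\<in>A. f \<alpha> \<le> N}. fps_nth F (nat (N - f \<alpha>)))"
    by (rule sum.group) (use fin L' in auto)
  finally show ?thesis .
qed

section \<open>Shifted weights as integer vectors\<close>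

definition heights :: "nat \<Rightarrow> (nat \<Rightarrow> nat) \<Rightarrow> nat \<Rightarrow> int" where
  "heights n c k = (\<Sum>i=k..n-1. int (c i) + 1)"

lemma heights_step: "k < n \<Longrightarrow> heights n c k = heights n c (k + 1) + int (c k) + 1"
  unfolding heights_def by (subst sum.atLeast_Suc_atMost) auto

lemma heights_less: "i < j \<Longrightarrow> j \<le> n \<Longrightarrow> heights n c j < heights n c i"
proof (induction j)
  case (Suc j)
  then show ?case using heights_step[of j n c] by (cases "i = j") auto
qed simp

lemma heights_wrap:
  assumes "n \<ge> 1" "int (c n) = r - int n - (\<Sum>i=1..n-1. int (c i))"
  shows "heights n c n = heights n c 1 - r + int (c n) + 1"
  using assms by (simp add: heights_def sum.distrib)

text \<open>Up to a multiple of \<open>(1, \<dots>, 1)\<close>, which the pairings with vectors of sum zero do not see, the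
  shifted weight is the integer vector \<open>heights\<close>.\<close>

lemma weight_plus_rho:
  assumes n: "n \<ge> 1"
  shows "\<exists>C. \<forall>k\<in>{1..n}. weight_of n c k + weyl_vector n k = of_int (heights n c k) - C"
proof (intro exI ballI)
  fix k assume k: "k \<in> {1..n}"
  let ?C = "\<Sum>i=1..n-1. of_nat (c i + 1) * (of_nat i / of_nat n) :: rat"
  have "{1..n} = insert n {1..n-1}" using n by auto
  moreover have "fund_weight n n k = 0" using n k by (simp add: fund_weight_def)
  ultimately have "weight_of n c k = (\<Sum>i=1..n-1. of_nat (c i) * fund_weight n i k)"
    using n by (simp add: weight_of_def)
  moreover have "{0..n-1} = insert 0 {1..n-1}" by auto
  then have "weyl_vector n k = (\<Sum>i=1..n-1. fund_weight n i k)"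
    using k by (simp add: weyl_vector_def fund_weight_def)
  ultimately have "weight_of n c k + weyl_vector n k = (\<Sum>i=1..n-1. of_nat (c i + 1) * fund_weight n i k)"
    by (simp add: sum.distrib[symmetric] algebra_simps)
  also have "\<dots> = (\<Sum>i=1..n-1. (if k \<le> i then of_nat (c i + 1) else 0) - of_nat (c i + 1) * (of_nat i / of_nat n))"
    using k by (intro sum.cong refl) (simp add: fund_weight_def algebra_simps)
  also have "\<dots> = (\<Sum>i=1..n-1. if k \<le> i then of_nat (c i + 1) else 0) - ?C"
    by (rule sum_subtractf)
  also have "(\<Sum>i=1..n-1. if k \<le> i then of_nat (c i + 1) else 0) = (\<Sum>i\<in>{i\<in>{1..n-1}. k \<le> i}. of_nat (c i + 1) :: rat)"
    by (rule sum.inter_filter[symmetric]) simp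
  also have "{i\<in>{1..n-1}. k \<le> i} = {k..n-1}" using k by auto
  also have "(\<Sum>i=k..n-1. of_nat (c i + 1) :: rat) = of_int (heights n c k)"
    by (simp add: heights_def add.commute)
  finally show "weight_of n c k + weyl_vector n k = of_int (heights n c k) - ?C" .
qed

context cylinder
begin

lemma root_lattice_eq: "root_lattice n = (\<lambda>\<alpha> k. of_int (\<alpha> k)) ` zero_sum"
proof (intro equalityI subsetI)
  fix \<alpha> assume \<alpha>: "\<alpha> \<in> root_lattice n"
  have ints: "of_int \<lfloor>\<alpha> k\<rfloor> = \<alpha> k" for k using root_lattice_Ints[OF \<alpha>, of k] by simp
  have "\<alpha> k = 0" if "k \<notin> {1..n}" for k
    using \<alpha> that by (auto simp: root_lattice_def simple_root_def intro!: sum.neutral)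
  moreover have "rat_of_int (\<Sum>k=1..n. \<lfloor>\<alpha> k\<rfloor>) = 0"
    using root_lattice_sum[OF \<alpha>] by (simp add: ints)
  then have "(\<Sum>k=1..n. \<lfloor>\<alpha> k\<rfloor>) = 0" by (simp only: of_int_eq_0_iff)
  ultimately have "(\<lambda>k. \<lfloor>\<alpha> k\<rfloor>) \<in> zero_sum" by (simp add: zero_sum_def)
  then show "\<alpha> \<in> (\<lambda>\<alpha> k. of_int (\<alpha> k)) ` zero_sum" by (intro image_eqI[of _ _ "\<lambda>k. \<lfloor>\<alpha> k\<rfloor>"]) (simp_all add: ints)
next
  fix \<beta> :: "nat \<Rightarrow> rat" assume "\<beta> \<in> (\<lambda>\<alpha> k. of_int (\<alpha> k)) ` zero_sum"
  then obtain \<alpha> where \<alpha>: "\<alpha> \<in> zero_sum" and \<beta>: "\<beta> = (\<lambda>k. of_int (\<alpha> k))" by auto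
  \<comment> \<open>The coefficients with respect to the simple roots are the partial sums of the coordinates.\<close>
  define c where "c = (\<lambda>i. \<Sum>k=1..i. \<alpha> k)"
  have c0: "c 0 = 0" "c n = 0" using \<alpha> by (simp_all add: c_def zero_sum_def)
  have "\<beta> k = (\<Sum>i=1..n-1. of_int (c i) * simple_root i k)" for k
  proof -
    have "(\<Sum>i=1..n-1. of_int (c i) * simple_root i k) =
        (\<Sum>i=1..n-1. (if i = k then of_int (c i) else 0) - (if i = k - 1 then (if k = 0 then 0 else of_int (c i)) else 0))"
      by (intro sum.cong refl) (auto simp: simple_root_def)
    also have "\<dots> = (if k \<in> {1..n-1} then of_int (c k) else 0) - (if k - 1 \<in> {1..n-1} then (if k = 0 then 0 else of_int (c (k - 1))) else 0)"
      by (simp only: sum_subtractf sum.delta finite_atLeastAtMost)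
    also have "\<dots> = of_int (\<alpha> k)"
    proof (cases "k \<in> {1..n}")
      case True
      then have "c k = c (k - 1) + \<alpha> k" by (cases k) (simp_all add: c_def)
      moreover have "(if k \<in> {1..n-1} then of_int (c k) else 0) = rat_of_int (c k)"
        using True c0 by (cases "k = n") auto
      moreover have "(if k - 1 \<in> {1..n-1} then (if k = 0 then 0 else of_int (c (k - 1))) else 0) = rat_of_int (c (k - 1))"
        using True c0 by (cases "k = 1") auto
      ultimately show ?thesis by simp
    next
      case False
      then show ?thesis using \<alpha> by (auto simp: zero_sum_def)
    qed
    finally show ?thesis by (simp add: \<beta>)
  qed
  then show "\<beta> \<in> root_lattice n" unfolding root_lattice_def by blast
qed

lemma theta_exponent_eq_energy:
  assumes \<sigma>: "\<sigma> permutes {1..n}" and \<alpha>: "\<alpha> \<in> zero_sum"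
    and X: "X = heights n b" and Y: "Y = heights n a"
  shows "theta_exponent n p' p (weight_of n a) (weight_of n b) \<sigma> (\<lambda>k. of_int (\<alpha> k)) = of_int (energy \<sigma> \<alpha>)"
proof -
  define x where "x = (\<lambda>k. weight_of n b k + weyl_vector n k)"
  define y where "y = (\<lambda>k. weight_of n a k + weyl_vector n k)"
  obtain C where C: "\<And>k. k \<in> {1..n} \<Longrightarrow> x k = of_int (X k) - C"
    using weight_plus_rho[OF n_pos, of b] unfolding X x_def by blast
  obtain D where D: "\<And>k. k \<in> {1..n} \<Longrightarrow> y k = of_int (Y k) - D"
    using weight_plus_rho[OF n_pos, of a] unfolding Y y_def by blast
  have inv_mem: "inv \<sigma> k \<in> {1..n}" if "k \<in> {1..n}" for k
    using permutes_in_image[OF permutes_inv[OF \<sigma>]] that by blast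
  have C': "x (inv \<sigma> k) = of_int (X (inv \<sigma> k)) - C" if "k \<in> {1..n}" for k
    by (rule C[OF inv_mem[OF that]])
  have sum0: "(\<Sum>k=1..n. rat_of_int (\<alpha> k)) = 0"
    using \<alpha> unfolding zero_sum_def by (simp flip: of_int_sum)
  have sumX: "(\<Sum>k=1..n. rat_of_int (X k - X (inv \<sigma> k))) = 0"
    using inv_sum[OF \<sigma>, of X] by (simp add: sum_subtractf flip: of_int_sum)
  have "rat_of_int (2 * ((\<Sum>k=1..n. \<alpha> k * \<alpha> k) div 2)) = weight_form n (\<lambda>k. of_int (\<alpha> k)) (\<lambda>k. of_int (\<alpha> k))"
    unfolding even_sum_squares[OF \<alpha>] by (simp add: weight_form_def)
  then have 1: "of_int p' * of_int p / 2 * weight_form n (\<lambda>k. of_int (\<alpha> k)) (\<lambda>k. of_int (\<alpha> k)) =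
      rat_of_int (p * p' * ((\<Sum>k=1..n. \<alpha> k * \<alpha> k) div 2))" by simp
  have "weight_form n (\<lambda>k. of_int p' * weyl_act \<sigma> x k - of_int p * y k) (\<lambda>k. of_int (\<alpha> k)) =
      (\<Sum>k=1..n. of_int ((p' * X (inv \<sigma> k) - p * Y k) * \<alpha> k) + (of_int p * D - of_int p' * C) * of_int (\<alpha> k))"
    unfolding weight_form_def weyl_act_def
    by (intro sum.cong refl) (simp add: C C' D algebra_simps)
  also have "\<dots> = rat_of_int (\<Sum>k=1..n. (p' * X (inv \<sigma> k) - p * Y k) * \<alpha> k)"
    by (simp only: sum.distrib sum_distrib_left[symmetric] sum0 of_int_sum mult_zero_right add_0_right)
  finally have 2: "weight_form n (\<lambda>k. of_int p' * weyl_act \<sigma> x k - of_int p * y k) (\<lambda>k. of_int (\<alpha> k)) =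
      rat_of_int (\<Sum>k=1..n. (p' * X (inv \<sigma> k) - p * Y k) * \<alpha> k)" .
  have "weight_form n (\<lambda>k. x k - weyl_act \<sigma> x k) y =
      (\<Sum>k=1..n. of_int ((X k - X (inv \<sigma> k)) * Y k) + (- D) * of_int (X k - X (inv \<sigma> k)))"
    unfolding weight_form_def weyl_act_def
    by (intro sum.cong refl) (simp add: C C' D algebra_simps)
  also have "\<dots> = rat_of_int (\<Sum>k=1..n. (X k - X (inv \<sigma> k)) * Y k)"
    by (simp only: sum.distrib sum_distrib_left[symmetric] sumX of_int_sum mult_zero_right add_0_right)
  finally have 3: "weight_form n (\<lambda>k. x k - weyl_act \<sigma> x k) y = rat_of_int (\<Sum>k=1..n. (X k - X (inv \<sigma> k)) * Y k)" .
  show ?thesis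
    unfolding theta_exponent_def Let_def x_def[symmetric] y_def[symmetric] 1 2 3 energy_def
    by (simp only: of_int_add)
qed

end

section \<open>The character formula\<close>

lemma finite_tuples: "finite {\<Lambda> \<in> {1..n::nat} \<rightarrow>\<^sub>E fin_partitions. (\<Sum>i=1..n. partition_size (\<Lambda> i)) = m}"
  and partition_series_power_nth:
    "fps_nth (partition_series ^ n) m = of_nat (card {\<Lambda> \<in> {1..n} \<rightarrow>\<^sub>E fin_partitions. (\<Sum>i=1..n. partition_size (\<Lambda> i)) = m})"
proof -
  have "finite {\<mu>\<in>fin_partitions. partition_size \<mu> = m}" for m
    using fin_partitions_eq_partitions_le[of m m] finite_partitions_le by simp
  note tuples = power_series_counts_tuples[where 'c = rat and I = "{1..n}" and P = fin_partitions and sz = partition_size and m = m,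
      OF finite_atLeastAtMost this]
  show "finite {\<Lambda> \<in> {1..n::nat} \<rightarrow>\<^sub>E fin_partitions. (\<Sum>i=1..n. partition_size (\<Lambda> i)) = m}"
    "fps_nth (partition_series ^ n) m = of_nat (card {\<Lambda> \<in> {1..n} \<rightarrow>\<^sub>E fin_partitions. (\<Sum>i=1..n. partition_size (\<Lambda> i)) = m})"
    using tuples by (simp_all add: partition_series_def)
qed

lemma module_character_nth:
  "fps_nth (module_character n a b) m = of_nat (card {\<Lambda> \<in> partition_tuples n a b. (\<Sum>i=1..n. partition_size (\<Lambda> i)) = m})"
proof -
  let ?s = "\<lambda>\<Lambda>. \<Sum>i=1..n. partition_size (\<Lambda> i)"
  have fin: "finite {\<Lambda> \<in> partition_tuples n a b. ?s \<Lambda> = m}" for m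
    by (rule finite_subset[OF _ finite_tuples[of n m]]) (auto simp: partition_tuples_def)
  have eq: "{\<Lambda> \<in> partition_tuples n a b. fps_nth (fps_X ^ ?s \<Lambda> :: rat fps) m \<noteq> 0} =
      {\<Lambda> \<in> partition_tuples n a b. ?s \<Lambda> = m}" for m by auto
  have "((\<lambda>\<Lambda>. fps_X ^ ?s \<Lambda> :: rat fps) has_sum
      Abs_fps (\<lambda>m. of_nat (card {\<Lambda> \<in> partition_tuples n a b. ?s \<Lambda> = m}))) (partition_tuples n a b)"
  proof (rule has_sum_fpsI)
    fix m
    show "finite {\<Lambda> \<in> partition_tuples n a b. fps_nth (fps_X ^ ?s \<Lambda> :: rat fps) m \<noteq> 0}"
      unfolding eq by (rule fin)
    show "fps_nth (Abs_fps (\<lambda>m. of_nat (card {\<Lambda> \<in> partition_tuples n a b. ?s \<Lambda> = m}))) m =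
        (\<Sum>\<Lambda> | \<Lambda> \<in> partition_tuples n a b \<and> fps_nth (fps_X ^ ?s \<Lambda> :: rat fps) m \<noteq> 0. fps_nth (fps_X ^ ?s \<Lambda>) m)"
      unfolding eq by simp
  qed
  from infsumI[OF this] show ?thesis unfolding module_character_def by simp
qed

lemma one_over_q_infty: "1 / fps_to_fls q_infty = fps_to_fls partition_series"
proof -
  have "fps_to_fls partition_series * fps_to_fls q_infty = 1"
    by (simp only: fls_times_fps_to_fls[symmetric] partition_series_times_q_infty) simp
  then show ?thesis by (metis mult_zero_right nonzero_eq_divide_eq zero_neq_one)
qed

lemma fls_nth_sign_mult: "fls_nth (of_int (sign \<sigma>) * B) N = of_int (sign \<sigma>) * fls_nth B (N :: int)"
  by (simp add: sign_def)

theorem theorem4p5: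
  fixes n :: nat and p p' :: int and a b :: "nat \<Rightarrow> nat"
  assumes "n \<ge> 2" and "p \<ge> int n" and "p' > int n" and "p' \<noteq> p"
    and "int (a n) = p' - int n - (\<Sum>i=1..n-1. int (a i))"
    and "int (b n) = p - int n - (\<Sum>i=1..n-1. int (b i))"
  shows "fps_to_fls (module_character n a b) =
           1 / fps_to_fls q_infty * chi_bar n p' p (weight_of n a) (weight_of n b)"
proof (rule fls_eqI)
  fix N :: int
  define X where "X = heights n b"
  define Y where "Y = heights n a"
  have n: "n \<ge> 1" using assms(1) by simp
  have X_last: "X n = X 1 - p + int (b n) + 1" unfolding X_def using n assms(6) by (rule heights_wrap)
  have Y_last: "Y n = Y 1 - p' + int (a n) + 1" unfolding Y_def using n assms(5) by (rule heights_wrap)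
  interpret cylinder n p p' X Y
    by unfold_locales (use assms n X_last Y_last heights_less in \<open>simp_all add: X_def Y_def\<close>)
  let ?\<theta> = "\<lambda>\<sigma> \<alpha>. \<lfloor>theta_exponent n p' p (weight_of n a) (weight_of n b) \<sigma> \<alpha>\<rfloor>"
  let ?s = "\<lambda>\<Lambda>. \<Sum>j=1..n. partition_size (\<Lambda> j)"
  have inj: "inj_on (\<lambda>\<alpha> k. rat_of_int (\<alpha> k)) zero_sum"
    by (rule inj_onI) (auto simp: fun_eq_iff)
  have theta: "(\<Sum>\<^sub>\<infinity>\<alpha>\<in>root_lattice n. fls_X_intpow (?\<theta> \<sigma> \<alpha>)) =
      (\<Sum>\<^sub>\<infinity>\<alpha>\<in>zero_sum. fls_X_intpow (energy \<sigma> \<alpha>) :: rat fls)" if \<sigma>: "\<sigma> permutes {1..n}" for \<sigma>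
  proof -
    have "(\<Sum>\<^sub>\<infinity>\<alpha>\<in>root_lattice n. fls_X_intpow (?\<theta> \<sigma> \<alpha>)) =
        (\<Sum>\<^sub>\<infinity>\<alpha>\<in>zero_sum. fls_X_intpow (?\<theta> \<sigma> (\<lambda>k. of_int (\<alpha> k))) :: rat fls)"
      unfolding root_lattice_eq by (simp add: infsum_reindex[OF inj] o_def)
    also have "\<dots> = (\<Sum>\<^sub>\<infinity>\<alpha>\<in>zero_sum. fls_X_intpow (energy \<sigma> \<alpha>))"
      by (rule infsum_cong) (simp add: theta_exponent_eq_energy[OF \<sigma> _ X_def Y_def])
    finally show ?thesis .
  qed
  have coeff: "fls_nth (fps_to_fls (partition_series ^ n) * (\<Sum>\<^sub>\<infinity>\<alpha>\<in>zero_sum. fls_X_intpow (energy \<sigma> \<alpha>))) N =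
      of_int (\<Sum>\<alpha>\<in>{\<alpha>\<in>zero_sum. energy \<sigma> \<alpha> \<le> N}. int (tuple_count (N - energy \<sigma> \<alpha>)))"
    if \<sigma>: "\<sigma> permutes {1..n}" for \<sigma>
  proof -
    have "fps_nth (partition_series ^ n) (nat (N - energy \<sigma> \<alpha>)) = of_nat (tuple_count (N - energy \<sigma> \<alpha>))"
      if "energy \<sigma> \<alpha> \<le> N" for \<alpha>
    proof -
      have "?s \<Lambda> = nat (N - energy \<sigma> \<alpha>) \<longleftrightarrow> int (?s \<Lambda>) = N - energy \<sigma> \<alpha>" for \<Lambda> :: "nat \<Rightarrow> nat \<Rightarrow> nat"
        using that by (simp only: nat_eq_iff2 diff_ge_0_iff_ge if_True) (rule eq_commute)
      then show ?thesis unfolding partition_series_power_nth tuple_count_def by simp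
    qed
    then show ?thesis
      unfolding fps_to_fls_times_theta_nth[OF finite_energy_le[OF \<sigma>]] of_int_sum by (intro sum.cong) auto
  qed
  have "1 / fps_to_fls q_infty * chi_bar n p' p (weight_of n a) (weight_of n b) =
      fps_to_fls (partition_series ^ n) *
      (\<Sum>\<sigma> | \<sigma> permutes {1..n}. of_int (sign \<sigma>) * (\<Sum>\<^sub>\<infinity>\<alpha>\<in>zero_sum. fls_X_intpow (energy \<sigma> \<alpha>)))"
  proof -
    have "1 / fps_to_fls q_infty ^ (n - 1) = (1 / fps_to_fls q_infty) ^ (n - 1)"
      by (simp add: power_one_over)
    then have "1 / fps_to_fls q_infty * (1 / fps_to_fls q_infty ^ (n - 1)) = fps_to_fls (partition_series ^ n)"
      using power_eq_if[of "fps_to_fls partition_series" n] n by (simp add: one_over_q_infty fps_to_fls_power)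
    moreover have "(\<Sum>\<sigma> | \<sigma> permutes {1..n}. (-1) ^ perm_length n \<sigma> * (\<Sum>\<^sub>\<infinity>\<alpha>\<in>root_lattice n. fls_X_intpow (?\<theta> \<sigma> \<alpha>))) =
        (\<Sum>\<sigma> | \<sigma> permutes {1..n}. of_int (sign \<sigma>) * (\<Sum>\<^sub>\<infinity>\<alpha>\<in>zero_sum. fls_X_intpow (energy \<sigma> \<alpha>) :: rat fls))"
      by (intro sum.cong refl) (simp add: theta minus_one_power_perm_length)
    ultimately show ?thesis unfolding chi_bar_def by (simp only: mult.assoc[symmetric])
  qed
  also have "fls_nth \<dots> N = (\<Sum>\<sigma> | \<sigma> permutes {1..n}. of_int (sign \<sigma>) *
      fls_nth (fps_to_fls (partition_series ^ n) * (\<Sum>\<^sub>\<infinity>\<alpha>\<in>zero_sum. fls_X_intpow (energy \<sigma> \<alpha>))) N)"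
    by (simp only: sum_distrib_left mult.left_commute[of "fps_to_fls _"] fls_nth_sum fls_nth_sign_mult)
  also have "\<dots> = of_int (\<Sum>\<sigma> | \<sigma> permutes {1..n}. sign \<sigma> *
      (\<Sum>\<alpha>\<in>{\<alpha>\<in>zero_sum. energy \<sigma> \<alpha> \<le> N}. int (tuple_count (N - energy \<sigma> \<alpha>))))"
    unfolding of_int_sum[where A = "{\<sigma>. \<sigma> permutes {1..n}}"] of_int_mult
    by (intro sum.cong refl) (simp only: mem_Collect_eq coeff)
  also have "\<dots> = of_int (\<Sum>c\<in>{c\<in>configs. total c = N}. sign (fst c))"
    by (simp only: sum_sign_configs_eq(2)[OF finite_tuples])
  also have "\<dots> = of_int (int (card {\<Lambda> \<in> partition_tuples n a b. int (?s \<Lambda>) = N}))"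
  proof -
    have "card {h \<in> families id (\<lambda>_. 0). total_area id (\<lambda>_. 0) h = N \<and> meets h = {}} =
        card {\<Lambda> \<in> partition_tuples n a b. int (?s \<Lambda>) = N}"
    proof (rule card_no_meeting)
      show "X i = X (i + 1) + int (b i) + 1" "Y i = Y (i + 1) + int (a i) + 1" if "i < n" for i
        unfolding X_def Y_def using that by (rule heights_step)+
    qed (rule X_last Y_last)+
    then show ?thesis unfolding sum_sign_configs[OF sum_sign_configs_eq(1)[OF finite_tuples]] by simp
  qed
  also have "\<dots> = fls_nth (fps_to_fls (module_character n a b)) N"
  proof (cases "N < 0")
    case True
    have "int m \<noteq> N" for m using True by simp
    then have "{\<Lambda> \<in> partition_tuples n a b. int (?s \<Lambda>) = N} = {}" by blast
    then show ?thesis using True by (simp only: card.empty) simp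
  next
    case False
    then have "int m = N \<longleftrightarrow> m = nat N" for m by auto
    then show ?thesis using False by (simp add: module_character_nth del: of_nat_sum)
  qed
  finally show "fls_nth (fps_to_fls (module_character n a b)) N =
      fls_nth (1 / fps_to_fls q_infty * chi_bar n p' p (weight_of n a) (weight_of n b)) N" by (rule sym)
qed

end
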